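(* Let $A=R/I$ be a Gorenstein Artinian graded algebra of socle degree $e$. If $A$ has the Weak Lefschetz Property, then the non-Lefschetz locus of forms of degree $2$ of $A$ is defined, as a subscheme of $\mathbb{P}^{N-1}$, by the ideal in the middle degree: $$I(\mathcal{C}_A)=I\big(\mathcal{C}_{A,\lfloor e/2\rfloor-1}\big).$$
   Context: $\Bbbk$ is an algebraically closed field of characteristic $0$, $R=\Bbbk[x_1,\dots,x_n]$ with the standard grading, $I\subset R$ is a homogeneous ideal, and $N=\binom{n+1}{2}=\dim_\Bbbk[R]_2$. For the Artinian algebra $A=\bigoplus_{i=0}^e[A]_i$ write $h_i=\dim_\Bbbk[A]_i$. $A$ has the Weak Lefschetz Property if there is a linear form $\ell\in[R]_1$ such that $\times\ell:[A]_i\to[A]_{i+1}$ has maximal rank (is injective or surjective) for every $i$. Non-Lefschetz locus of forms of degree $2$: let $S=\Bbbk[a_1,\dots,a_N]$ be the coordinate ring of $\mathbb{P}^{N-1}=\mathbb{P}([R]_2)$, where $a_1,\dots,a_N$ are the coefficients of the generic quadratic form $C=a_1x_1^2+a_2x_1x_2+\dots+a_Nx_n^2$. For each $i$, after choosing bases of $[A]_i$ and $[A]_{i+2}$, multiplication $\times C:S\otimes_\Bbbk[A]_i\to S\otimes_\Bbbk[A]_{i+2}$ is represented by an $h_{i+2}\times h_i$ matrix $B_i$ of linear forms in $S$. $I(\mathcal{C}_{A,i})\subseteq S$ is the ideal of maximal minors of $B_i$ (independent of the choice of bases), and $I(\mathcal{C}_A)=\bigcap_{0\le i\le e-2}I(\mathcal{C}_{A,i})$.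 *)

theory Defs
  imports
    "HOL-Library.Poly_Mapping"
    "HOL-Library.Uprod"
    "HOL-Computational_Algebra.Polynomial"
    "Jordan_Normal_Form.Determinant"
    "Jordan_Normal_Form.DL_Submatrix"
begin

section \<open>Polynomial rings and ideals\<close>

text \<open>The polynomial ring over \<open>'k\<close> in the variables indexed by the type \<open>'v\<close>. The type
  \<open>('n, 'k) mpol\<close> with \<open>'n\<close> finite is \<open>R\<close>, where \<open>n = CARD('n)\<close>.\<close>

type_synonym ('v, 'k) mpol = "('v \<Rightarrow>\<^sub>0 nat) \<Rightarrow>\<^sub>0 'k"

definition pconst :: "'k::zero \<Rightarrow> ('v, 'k) mpol" where
  "pconst c = Poly_Mapping.single 0 c"

definition pvar :: "'v \<Rightarrow> ('v, 'k::zero_neq_one) mpol" where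
  "pvar i = Poly_Mapping.single (Poly_Mapping.single i 1) 1"

text \<open>Ideals of a commutative ring are the submodules of the ring over itself, and the ideal
  generated by a set is its linear span.\<close>

global_interpretation ideal: Modules.module "(*) :: 'a::comm_ring_1 \<Rightarrow> 'a \<Rightarrow> 'a"
  defines is_ideal = ideal.subspace
    and ideal_gen = ideal.span
  by standard (simp_all add: algebra_simps)

definition forms :: "nat \<Rightarrow> ('n::finite, 'k::zero) mpol set" where
  "forms d = {p. \<forall>m \<in> Poly_Mapping.keys p. (\<Sum>i\<in>UNIV. Poly_Mapping.lookup m i) = d}"

definition homogeneous_ideal :: "('n::finite, 'k::comm_ring_1) mpol set \<Rightarrow> bool" where
  "homogeneous_ideal I \<longleftrightarrow> (\<exists>G. G \<subseteq> (\<Union>d. forms d) \<and> I = ideal_gen G)"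

section \<open>The graded algebra \<open>A = R/I\<close>\<close>

text \<open>Elements of \<open>A\<close> are represented by polynomials; \<open>p\<close> and \<open>q\<close> are equal in \<open>A\<close> iff
  \<open>p - q \<in> I\<close>, and the degree \<open>d\<close> component of \<open>A\<close> consists of the classes of \<open>forms d\<close>.\<close>

text \<open>Descending chain condition on the ideals of \<open>A\<close>, that is, the ideals of \<open>R\<close> that
  contain \<open>I\<close>.\<close>

definition artinian_quotient :: "'a::comm_ring_1 set \<Rightarrow> bool" where
  "artinian_quotient I \<longleftrightarrow>
     (\<forall>J :: nat \<Rightarrow> 'a set.
        (\<forall>k. is_ideal (J k) \<and> I \<subseteq> J k \<and> J (Suc k) \<subseteq> J k) \<longrightarrow> (\<exists>m. \<forall>k\<ge>m. J k = J m))"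

definition socle_degree :: "('n::finite, 'k::comm_ring_1) mpol set \<Rightarrow> nat \<Rightarrow> bool" where
  "socle_degree I e \<longleftrightarrow> \<not> forms e \<subseteq> I \<and> (\<forall>d>e. forms d \<subseteq> I)"

text \<open>The preimage in \<open>R\<close> of the socle of \<open>A\<close>, the annihilator of the maximal ideal generated
  by the variables.\<close>

definition socle :: "('n, 'k::comm_ring_1) mpol set \<Rightarrow> ('n, 'k) mpol set" where
  "socle I = {p. \<forall>i. pvar i * p \<in> I}"

text \<open>An Artinian graded algebra is Gorenstein if its socle is a one-dimensional vector space.\<close>

definition gorenstein_artinian :: "('n, 'k::comm_ring_1) mpol set \<Rightarrow> bool" where
  "gorenstein_artinian I \<longleftrightarrow>
     artinian_quotient I \<and>
     (\<exists>s \<in> socle I. s \<notin> I \<and> (\<forall>p \<in> socle I. \<exists>c. p - pconst c * s \<in> I))"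

definition weak_lefschetz :: "('n::finite, 'k::comm_ring_1) mpol set \<Rightarrow> bool" where
  "weak_lefschetz I \<longleftrightarrow>
     (\<exists>l \<in> forms 1. \<forall>i.
        (\<forall>p \<in> forms i. \<forall>q \<in> forms i. l * p - l * q \<in> I \<longrightarrow> p - q \<in> I) \<or>
        (\<forall>q \<in> forms (Suc i). \<exists>p \<in> forms i. q - l * p \<in> I))"

section \<open>The non-Lefschetz locus of forms of degree 2\<close>

definition lin_comb :: "('n, 'k::comm_ring_1) mpol list \<Rightarrow> 'k vec \<Rightarrow> ('n, 'k) mpol" where
  "lin_comb bs v = (\<Sum>j<length bs. pconst (v $ j) * bs ! j)"

text \<open>The classes of \<open>bs\<close> form an (ordered) vector space basis of the degree \<open>d\<close> component
  of \<open>A\<close>.\<close>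

definition basis_mod ::
    "('n::finite, 'k::comm_ring_1) mpol set \<Rightarrow> nat \<Rightarrow> ('n, 'k) mpol list \<Rightarrow> bool" where
  "basis_mod I d bs \<longleftrightarrow>
     set bs \<subseteq> forms d \<and>
     (\<forall>v \<in> carrier_vec (length bs). lin_comb bs v \<in> I \<longrightarrow> v = 0\<^sub>v (length bs)) \<and>
     (\<forall>p \<in> forms d. \<exists>v \<in> carrier_vec (length bs). p - lin_comb bs v \<in> I)"

definition coords ::
    "('n, 'k::comm_ring_1) mpol set \<Rightarrow> ('n, 'k) mpol list \<Rightarrow> ('n, 'k) mpol \<Rightarrow> 'k vec" where
  "coords I bs p = (THE v. v \<in> carrier_vec (length bs) \<and> p - lin_comb bs v \<in> I)"

instance uprod :: (finite) finite
proof
  have "(UNIV :: 'a uprod set) = range (\<lambda>(x, y). Upair x y)"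
    by (metis (mono_tags, lifting) UNIV_eq_I case_prod_conv rangeI uprod_exhaust)
  then show "finite (UNIV :: 'a uprod set)"
    by (metis finite finite_imageI)
qed

text \<open>The monomials of degree 2 in \<open>R\<close> correspond to the unordered pairs of variables. So the
  coordinate ring \<open>S\<close> is \<open>('n uprod, 'k) mpol\<close>, with one variable \<open>pvar u\<close> for the coefficient of
  each monomial \<open>quad_monom u\<close>, and the generic quadratic form is the sum over all \<open>u\<close> of
  \<open>pvar u\<close> times \<open>quad_monom u\<close>.\<close>

lift_definition quad_monom :: "'n uprod \<Rightarrow> ('n, 'k::comm_ring_1) mpol"
  is "\<lambda>(i, j). pvar i * pvar j"
  by (auto simp: mult.commute)

lemma quad_monom_Upair: "quad_monom (Upair i j) = pvar i * pvar j"
  by transfer simp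

text \<open>The matrix over \<open>S\<close> of multiplication by the generic quadratic form, with respect to the
  basis \<open>bs\<close> of a component of \<open>A\<close> and the basis \<open>bs'\<close> of the component two degrees higher. As
  multiplication is extended linearly to \<open>S\<close>, it is the sum over all \<open>u\<close> of \<open>pvar u\<close> times the
  matrix of multiplication by \<open>quad_monom u\<close>.\<close>

definition generic_quadric_mat ::
    "('n::finite, 'k::comm_ring_1) mpol set \<Rightarrow> ('n, 'k) mpol list \<Rightarrow> ('n, 'k) mpol list \<Rightarrow>
     ('n uprod, 'k) mpol mat" where
  "generic_quadric_mat I bs bs' =
     mat (length bs') (length bs)
       (\<lambda>(r, c). \<Sum>u\<in>UNIV. pconst (coords I bs' (quad_monom u * bs ! c) $ r) * pvar u)"

text \<open>If one of the dimensions of the matrix is \<open>0\<close>, the only maximal minor is the empty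
  determinant \<open>1\<close>.\<close>

definition maximal_minors :: "'a::comm_ring_1 mat \<Rightarrow> 'a set" where
  "maximal_minors B =
     {det (submatrix B X Y) | X Y.
        X \<subseteq> {..<dim_row B} \<and> Y \<subseteq> {..<dim_col B} \<and>
        card X = min (dim_row B) (dim_col B) \<and> card Y = min (dim_row B) (dim_col B)}"

text \<open>The ideals \<open>I(C\<^bsub>A,i\<^esub>)\<close> and \<open>I(C\<^bsub>A\<^esub>)\<close>, where \<open>bas i\<close> is the chosen basis of the
  component of \<open>A\<close> of degree \<open>i\<close>. The middle degree is \<open>e div 2 - 1\<close>; for \<open>e < 2\<close> this truncates
  \<open>-1\<close> to \<open>0\<close>, which is harmless: the degree 2 component of \<open>A\<close> is then zero, so the ideal at \<open>0\<close> is the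
  unit ideal, just as the ideal at \<open>-1\<close>, where the source is zero.\<close>

definition nonlef_ideal_at ::
    "('n::finite, 'k::comm_ring_1) mpol set \<Rightarrow> (nat \<Rightarrow> ('n, 'k) mpol list) \<Rightarrow> nat \<Rightarrow>
     ('n uprod, 'k) mpol set" where
  "nonlef_ideal_at I bas i =
     ideal_gen (maximal_minors (generic_quadric_mat I (bas i) (bas (i + 2))))"

definition nonlef_ideal ::
    "('n::finite, 'k::comm_ring_1) mpol set \<Rightarrow> (nat \<Rightarrow> ('n, 'k) mpol list) \<Rightarrow> nat \<Rightarrow>
     ('n uprod, 'k) mpol set" where
  "nonlef_ideal I bas e = (\<Inter>i \<in> {i. i + 2 \<le> e}. nonlef_ideal_at I bas i)"

end

theory Submission
  imports Defs
begin

text \<open>Write \<open>B\<^sub>i\<close> for the matrix of multiplication by the generic quadric on degree \<open>i\<close> and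
  \<open>m = \<lfloor>e/2\<rfloor> - 1\<close>. The socle pairing identifies \<open>B\<^sub>i\<close> with the transpose of \<open>B\<^bsub>e-2-i\<^esub>\<close>, so only the
  degrees \<open>i \<le> m\<close> matter. By duality, the Lefschetz element \<open>l\<close> is injective in all degrees
  \<open>i < e/2\<close>, since surjectivity in degree \<open>i\<close> propagates to degree \<open>e - i - 1\<close>, which is
  dual to degree \<open>i\<close>. If \<open>L\<^sub>i\<close> is the matrix of multiplication by \<open>l\<close>, then
  \<open>B\<^bsub>i+1\<^esub> L\<^sub>i = L\<^bsub>i+2\<^esub> B\<^sub>i\<close>; as \<open>L\<^sub>i\<close> has a left inverse, Laplace expansion along the columns
  complementary to the image of \<open>L\<^sub>i\<close> and multilinearity put the maximal minors of \<open>B\<^bsub>i+1\<^esub>\<close>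
  into the ideal of maximal minors of \<open>B\<^sub>i\<close>. Hence the ideals shrink up to the middle
  degree.\<close>

section \<open>Ideals of maximal minors\<close>

text \<open>The simp rule \<open>a * (b * x) = (a * b) * x\<close> inherited from the module of ideals makes the simplifier
  loop with \<open>algebra_simps\<close>.\<close>

declare ideal.scale_scale [simp del]

lemma pick_lessThan: "c < k \<Longrightarrow> pick {..<k} c = c"
  using pick_reduce_set[of c k UNIV] by (simp add: pick_UNIV lessThan_def)

lemma card_bounded_mem: "X \<subseteq> {..<n} \<Longrightarrow> card {i. i < n \<and> i \<in> X} = card X"
  by (rule arg_cong[of _ _ card]) auto

text \<open>A repeated index gives two equal rows and determinant 0. Otherwise the rows chosen by
  \<open>f\<close> are those of a maximal minor in another order, so the determinant agrees with
  that minor up to sign.\<close>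

lemma det_row_selection_mem_minors:
  fixes M :: "'a::comm_ring_1 mat"
  assumes M: "M \<in> carrier_mat p k" and f: "\<And>r. r < k \<Longrightarrow> f r < p"
  shows "det (mat k k (\<lambda>(r, c). M $$ (f r, c))) \<in> ideal_gen (maximal_minors M)"
proof (cases "inj_on f {..<k}")
  case False
  then obtain r s where rs: "r < k" "s < k" "r \<noteq> s" "f r = f s"
    by (auto simp: inj_on_def)
  have "det (mat k k (\<lambda>(r, c). M $$ (f r, c))) = 0"
    by (rule det_identical_rows[of _ k r s]) (use rs in auto)
  then show ?thesis by (simp add: ideal.span_zero)
next
  case True
  define X where "X = f ` {..<k}"
  have X: "X \<subseteq> {..<p}" "card X = k" "finite X"
    using f True by (auto simp: X_def card_image)
  then have kp: "k \<le> p" by (metis card_lessThan card_mono finite_lessThan)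
  define S where "S = submatrix M X {..<k}"
  have cX: "card {i. i < p \<and> i \<in> X} = k" "card {j. j < k \<and> j \<in> {..<k}} = k"
    using card_bounded_mem[OF X(1)] X by (simp_all add: card_bounded_mem)
  then have S: "S \<in> carrier_mat k k"
    using M by (auto simp: S_def dim_submatrix)
  have S_index: "S $$ (r, c) = M $$ (pick X r, c)" if "r < k" "c < k" for r c
    using that M cX by (simp add: S_def submatrix_index pick_lessThan)
  have S_mem: "det S \<in> maximal_minors M"
    unfolding maximal_minors_def S_def using X M kp by fastforce
  \<comment> \<open>\<open>\<pi> r\<close> is the rank of \<open>f r\<close> within
    \<open>X\<close>, so \<open>pick X\<close> recovers \<open>f r\<close> from it. Outside
    \<open>{..<k}\<close> it is the identity, as \<open>permutes\<close> demands.\<close>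
  define \<pi> where "\<pi> r = (if r < k then card {a \<in> X. a < f r} else r)" for r
  have fX: "f r \<in> X" if "r < k" for r using that by (auto simp: X_def)
  have pick_pi: "pick X (\<pi> r) = f r" if "r < k" for r
    using that fX by (simp add: \<pi>_def pick_card_in_set)
  have pi_less: "\<pi> r < k" if "r < k" for r
  proof -
    have "{a \<in> X. a < f r} \<subset> X" using fX[OF that] by auto
    then show ?thesis using psubset_card_mono[OF X(3)] X(2) that by (simp add: \<pi>_def)
  qed
  have "inj_on \<pi> {0..<k}"
    using True pick_pi by (metis (no_types, lifting) atLeastLessThan_iff inj_on_def lessThan_iff)
  moreover from this have "\<pi> ` {0..<k} = {0..<k}"
    by (intro endo_inj_surj) (auto simp: pi_less)
  ultimately have "\<pi> permutes {0..<k}"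
    by (intro bij_imp_permutes) (auto simp: bij_betw_def \<pi>_def)
  from det_permute_rows[OF S this]
  have "det (mat k k (\<lambda>(r, c). S $$ (\<pi> r, c))) = signof \<pi> * det S" .
  moreover have "mat k k (\<lambda>(r, c). S $$ (\<pi> r, c)) = mat k k (\<lambda>(r, c). M $$ (f r, c))"
    by (rule cong_mat) (auto simp: S_index pi_less pick_pi)
  ultimately show ?thesis
    using S_mem by (simp add: ideal.span_base ideal.span_scale)
qed

text \<open>A Cauchy-Binet expansion with the terms left uncollected: linearity in the rows gives a
  sum over all row selections \<open>f\<close>, injective or not, and each term is a multiple of a
  determinant treated in the previous lemma.\<close>

lemma det_mult_mem_minors:
  fixes M :: "'a::comm_ring_1 mat"
  assumes M: "M \<in> carrier_mat p k" and P: "P \<in> carrier_mat k p"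
  shows "det (P * M) \<in> ideal_gen (maximal_minors M)"
proof -
  let ?F = "{f. (\<forall>i\<in>{0..<k}. f i \<in> {0..<p}) \<and> (\<forall>i. i \<notin> {0..<k} \<longrightarrow> f i = i)}"
  have "det (P * M) = (\<Sum>f\<in>?F. det (mat\<^sub>r k k (\<lambda>i. P $$ (i, f i) \<cdot>\<^sub>v row M (f i))))"
    unfolding mat_mul_finsum_alt[OF P M]
    by (rule det_linear_rows_sum) (use M in auto)
  also have "\<dots> = (\<Sum>f\<in>?F. (\<Prod>i=0..<k. P $$ (i, f i)) * det (mat k k (\<lambda>(r, c). M $$ (f r, c))))"
  proof (rule sum.cong[OF refl])
    fix f assume f: "f \<in> ?F"
    have "mat\<^sub>r k k (\<lambda>i. row M (f i)) = mat k k (\<lambda>(r, c). M $$ (f r, c))"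
      by (rule eq_matI) (use f M in auto)
    then show "det (mat\<^sub>r k k (\<lambda>i. P $$ (i, f i) \<cdot>\<^sub>v row M (f i))) =
        (\<Prod>i=0..<k. P $$ (i, f i)) * det (mat k k (\<lambda>(r, c). M $$ (f r, c)))"
      using M by (subst det_rows_mul) auto
  qed
  also have "\<dots> \<in> ideal_gen (maximal_minors M)"
    by (intro ideal.span_sum ideal.span_scale det_row_selection_mem_minors[OF M]) auto
  finally show ?thesis .
qed

text \<open>Laplace expansion along the columns complementary to the first \<open>k\<close>, one
  column at a time. Deleting the last column and a row leaves the first \<open>k\<close> columns of
  the form \<open>Y * M\<close>, with that row of \<open>Y\<close> deleted, until
  \<open>n = k\<close>.\<close>

lemma det_mult_columns_mem_minors:
  fixes M D :: "'a::comm_ring_1 mat"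
  assumes M: "M \<in> carrier_mat p k" and "k \<le> n" and "D \<in> carrier_mat n n"
    and "Y \<in> carrier_mat n p"
    and "\<And>r c. r < n \<Longrightarrow> c < k \<Longrightarrow> D $$ (r, c) = (Y * M) $$ (r, c)"
  shows "det D \<in> ideal_gen (maximal_minors M)"
  using assms(2-)
proof (induction n arbitrary: D Y rule: dec_induct)
  case base
  have "D = Y * M" by (rule eq_matI) (use base M in auto)
  then show ?case using det_mult_mem_minors[OF M, of Y] base by simp
next
  case (step n)
  have "det (mat_delete D r n) \<in> ideal_gen (maximal_minors M)" if r: "r < Suc n" for r
  proof (rule step.IH)
    let ?Y = "mat n p (\<lambda>(r', c). Y $$ (if r' < r then r' else Suc r', c))"
    show "mat_delete D r n \<in> carrier_mat n n"
      using mat_delete_carrier[OF step.prems(1)] by simp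
    show "?Y \<in> carrier_mat n p" by simp
    fix r' c assume rc: "r' < n" "c < k"
    then have "mat_delete D r n $$ (r', c) = D $$ (if r' < r then r' else Suc r', c)"
      using step.prems(1) step.hyps by (auto simp: mat_delete_def)
    also have "\<dots> = (Y * M) $$ (if r' < r then r' else Suc r', c)"
      using rc by (intro step.prems(3)) auto
    also have "\<dots> = (?Y * M) $$ (r', c)"
      using rc M step.prems(2) by (auto simp: scalar_prod_def)
    finally show "mat_delete D r n $$ (r', c) = (?Y * M) $$ (r', c)" .
  qed
  then show ?case
    unfolding laplace_expansion_column[OF step.prems(1) lessI] cofactor_def
    by (intro ideal.span_sum ideal.span_scale) auto
qed

text \<open>By induction on \<open>k\<close>: the last 1 on the diagonal is split off as a block of
  its own, and expansion along its column removes it.\<close>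

lemma det_four_block_one:
  fixes A :: "'a::comm_ring_1 mat"
  assumes A: "A \<in> carrier_mat n n"
  shows "det (four_block_mat A (0\<^sub>m n k) (0\<^sub>m k n) (1\<^sub>m k)) = det A"
proof (induction k)
  case 0
  have "four_block_mat A (0\<^sub>m n 0) (0\<^sub>m 0 n) (1\<^sub>m 0) = A"
    by (rule eq_matI) (use A in auto)
  then show ?case by simp
next
  case (Suc k)
  let ?B = "four_block_mat A (0\<^sub>m n k) (0\<^sub>m k n) (1\<^sub>m k)"
  have B: "?B \<in> carrier_mat (n + k) (n + k)" using A by auto
  have "four_block_mat A (0\<^sub>m n (Suc k)) (0\<^sub>m (Suc k) n) (1\<^sub>m (Suc k)) =
      four_block_mat ?B (0\<^sub>m (n + k) 1) (0\<^sub>m 1 (n + k)) (1\<^sub>m 1)"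
    (is "?C = ?E")
  proof (rule eq_matI)
    fix i j assume "i < dim_row ?E" "j < dim_col ?E"
    then have ij: "i < n + Suc k" "j < n + Suc k" using A by auto
    have "i - n = j - n \<longleftrightarrow> i = j" if "n \<le> i" "n \<le> j" using that by linarith
    then show "?C $$ (i, j) = ?E $$ (i, j)"
      using A ij by (cases "i < n + k"; cases "j < n + k"; cases "i < n"; cases "j < n"; simp)
  qed (use A in auto)
  then show ?case
    using det_four_block_mat_upper_right_zero_col[OF B refl] Suc by simp
qed

text \<open>With at least as many rows as columns, a maximal minor keeps every column, so only the
  choice of rows remains. Left multiplication by a 0-1 matrix performs that choice.\<close>

lemma maximal_minor_eq_det_mult:
  fixes N :: "'a::comm_ring_1 mat"
  assumes N: "N \<in> carrier_mat q l" and "l \<le> q" and d: "d \<in> maximal_minors N"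
  obtains P where "P \<in> carrier_mat l q" "d = det (P * N)"
proof -
  from d obtain X Y where XY: "d = det (submatrix N X Y)" "X \<subseteq> {..<q}" "Y \<subseteq> {..<l}"
    "card X = l" "card Y = l"
    using N \<open>l \<le> q\<close> by (auto simp: maximal_minors_def)
  have Y: "Y = {..<l}" using XY by (simp add: card_subset_eq)
  let ?P = "mat l q (\<lambda>(r, s). if s = pick X r then 1 else 0)"
  have cX: "card {i. i < q \<and> i \<in> X} = l" "card {j. j < l \<and> j \<in> {..<l}} = l"
    using card_bounded_mem[OF XY(2)] XY by (simp_all add: card_bounded_mem)
  have "submatrix N X Y = ?P * N"
  proof (rule eq_matI)
    fix r c assume rc: "r < dim_row (?P * N)" "c < dim_col (?P * N)"
    then have rc': "r < l" "c < l" using N by auto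
    have "pick X r < q" using rc' cX by (intro pick_le) simp
    have "(?P * N) $$ (r, c) = (\<Sum>s = 0..<q. (if s = pick X r then 1 else 0) * N $$ (s, c))"
      using rc' N by (simp add: scalar_prod_def)
    also have "\<dots> = (\<Sum>s = 0..<q. if s = pick X r then N $$ (s, c) else 0)"
      by (rule sum.cong) auto
    also have "\<dots> = N $$ (pick X r, c)"
      using \<open>pick X r < q\<close> by simp
    finally have "(?P * N) $$ (r, c) = N $$ (pick X r, c)" .
    then show "submatrix N X Y $$ (r, c) = (?P * N) $$ (r, c)"
      using rc' N cX by (simp add: Y submatrix_index pick_lessThan)
  qed (use N cX Y in \<open>auto simp: dim_submatrix\<close>)
  then show ?thesis using that[of ?P] XY by simp
qed

text \<open>Instead of completing the columns of \<open>L\<close> to a basis, the proof multiplies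
  \<open>diag (P N) 1\<close> by the invertible matrix \<open>(L, 1; 0, K)\<close>; the product has \<open>P L' M\<close> on top of \<open>0\<close>
  in its first columns.\<close>

lemma minors_ideal_mono:
  fixes M N L L' K :: "'a::comm_ring_1 mat"
  assumes M: "M \<in> carrier_mat p k" and N: "N \<in> carrier_mat q l" and "l \<le> q"
    and L: "L \<in> carrier_mat l k" and K: "K \<in> carrier_mat k l" and KL: "K * L = 1\<^sub>m k"
    and L': "L' \<in> carrier_mat q p" and eq: "N * L = L' * M"
  shows "ideal_gen (maximal_minors N) \<subseteq> ideal_gen (maximal_minors M)"
proof (rule ideal.span_minimal[OF _ ideal.subspace_span], rule subsetI)
  fix d assume "d \<in> maximal_minors N"
  then obtain P where P: "P \<in> carrier_mat l q" and d: "d = det (P * N)"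
    using maximal_minor_eq_det_mult[OF N \<open>l \<le> q\<close>] by blast
  define X where "X = P * N"
  have X: "X \<in> carrier_mat l l" using P N by (simp add: X_def)
  have "X * L = P * (L' * M)"
    unfolding X_def assoc_mult_mat[OF P N L] eq ..
  then have XL: "X * L = P * L' * M"
    unfolding assoc_mult_mat[OF P L' M] .
  let ?D = "four_block_mat X (0\<^sub>m l k) (0\<^sub>m k l) (1\<^sub>m k)"
  let ?W = "four_block_mat L (1\<^sub>m l) (0\<^sub>m k k) K"
  \<comment> \<open>A right inverse of \<open>?W\<close>: \<open>K * L = 1\<close> clears the block
    \<open>K * (1 - L * K)\<close> and supplies the lower identity block.\<close>
  let ?V = "four_block_mat K (- 1\<^sub>m k) (1\<^sub>m l - L * K) L"
  have D: "?D \<in> carrier_mat (l + k) (l + k)" using X by auto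
  have W: "?W \<in> carrier_mat (l + k) (l + k)"
    unfolding add.commute[of l k] by (rule four_block_carrier_mat[OF L K, unfolded add.commute[of l k]])
  have V: "?V \<in> carrier_mat (l + k) (l + k)"
    unfolding add.commute[of l k] by (rule four_block_carrier_mat[OF K L, unfolded add.commute[of l k]])
  have LK: "L * K \<in> carrier_mat l l" using L K by simp
  then have E: "1\<^sub>m l - L * K \<in> carrier_mat l l" by (rule minus_carrier_mat)
  have "?W * ?V = four_block_mat (L * K + 1\<^sub>m l * (1\<^sub>m l - L * K)) (L * (- 1\<^sub>m k) + 1\<^sub>m l * L)
      (0\<^sub>m k k * K + K * (1\<^sub>m l - L * K)) (0\<^sub>m k k * (- 1\<^sub>m k) + K * L)"
    by (rule mult_four_block_mat[OF L _ _ K K _ E L]) simp_all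
  moreover have "L * K + 1\<^sub>m l * (1\<^sub>m l - L * K) = 1\<^sub>m l"
    unfolding left_mult_one_mat[OF E] by (rule eq_matI) (use L K in auto)
  moreover have "L * (- 1\<^sub>m k) + 1\<^sub>m l * L = 0\<^sub>m l k"
  proof -
    have "L * (- 1\<^sub>m k) = - L"
      using L by simp
    then show ?thesis
      unfolding left_mult_one_mat[OF L] using L by (auto intro!: eq_matI)
  qed
  moreover have "0\<^sub>m k k * K + K * (1\<^sub>m l - L * K) = 0\<^sub>m k l"
  proof -
    have "K * (L * K) = K"
      unfolding assoc_mult_mat[OF K L K, symmetric] KL left_mult_one_mat[OF K] ..
    then have "K * (1\<^sub>m l - L * K) = K - K"
      unfolding mult_minus_distrib_mat[OF K one_carrier_mat LK] right_mult_one_mat[OF K] by simp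
    then show ?thesis using K by (auto intro!: eq_matI)
  qed
  moreover have "0\<^sub>m k k * (- 1\<^sub>m k) + K * L = 1\<^sub>m k"
    unfolding KL by (rule eq_matI) auto
  moreover have "four_block_mat (1\<^sub>m l) (0\<^sub>m l k) (0\<^sub>m k l) (1\<^sub>m k) = 1\<^sub>m (l + k)"
    by (auto intro!: eq_matI)
  ultimately have WV: "?W * ?V = 1\<^sub>m (l + k)"
    by (simp only:)
  have "?D * ?W = four_block_mat (X * L + 0\<^sub>m l k * 0\<^sub>m k k) (X * 1\<^sub>m l + 0\<^sub>m l k * K)
      (0\<^sub>m k l * L + 1\<^sub>m k * 0\<^sub>m k k) (0\<^sub>m k l * 1\<^sub>m l + 1\<^sub>m k * K)"
    by (rule mult_four_block_mat[OF X _ _ one_carrier_mat L _ _ K]) simp_all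
  also have "\<dots> = four_block_mat (P * L' * M) X (0\<^sub>m k k) K"
    proof -
    have "X * 1\<^sub>m l + 0\<^sub>m l k * K = X" "0\<^sub>m k l * L + 1\<^sub>m k * 0\<^sub>m k k = 0\<^sub>m k k"
      "0\<^sub>m k l * 1\<^sub>m l + 1\<^sub>m k * K = K" "0\<^sub>m l k * 0\<^sub>m k k = (0\<^sub>m l k :: 'a mat)"
      using X L K by simp_all
    moreover have "P * L' * M + 0\<^sub>m l k = P * L' * M"
      by (rule right_add_zero_mat) (use P L' M in auto)
    ultimately show ?thesis unfolding XL by (simp only:)
  qed
  finally have DW: "?D * ?W = four_block_mat (P * L' * M) X (0\<^sub>m k k) K" .
  have PL: "P * L' \<in> carrier_mat l p" using P L' by simp
  \<comment> \<open>\<open>P * L'\<close> extended by \<open>k\<close> zero rows, to match the zero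
    block under \<open>P * L' * M\<close>.\<close>
  let ?Y = "mat (l + k) p (\<lambda>(r, c). if r < l then (P * L') $$ (r, c) else 0)"
  have "det (?D * ?W) \<in> ideal_gen (maximal_minors M)"
  proof (rule det_mult_columns_mem_minors[OF M])
    show "?D * ?W \<in> carrier_mat (l + k) (l + k)" using D W by (rule mult_carrier_mat)
    show "?Y \<in> carrier_mat (l + k) p" by simp
    fix r c assume rc: "r < l + k" "c < k"
    have "(?D * ?W) $$ (r, c) = (if r < l then (P * L' * M) $$ (r, c) else 0)"
      unfolding DW using P L' M K X rc by simp
    also have "\<dots> = (?Y * M) $$ (r, c)"
    proof -
      obtain Z where Z: "Z = P * L'" by simp
      have Zc: "Z \<in> carrier_mat l p" using PL Z by simp
      show ?thesis
        using rc Zc M unfolding Z[symmetric] by (auto simp: scalar_prod_def intro!: sum.cong)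
    qed
    finally show "(?D * ?W) $$ (r, c) = (?Y * M) $$ (r, c)" .
  qed simp
  \<comment> \<open>The factor \<open>det ?V\<close> cancels \<open>det ?W\<close>, because
    \<open>?W * ?V\<close> is the identity. What remains is \<open>det X\<close>, the given
    minor.\<close>
  then have "det ?V * det (?D * ?W) \<in> ideal_gen (maximal_minors M)"
    by (rule ideal.span_scale)
  moreover have "det ?V * det (?D * ?W) = det X * det (?W * ?V)"
    unfolding det_mult[OF D W] det_mult[OF W V] det_four_block_one[OF X] by (simp only: mult_ac)
  ultimately show "d \<in> ideal_gen (maximal_minors M)"
    by (simp add: WV d X_def)
qed

lemma maximal_minors_transpose:
  fixes B :: "'a::comm_ring_1 mat"
  shows "maximal_minors (transpose_mat B) = maximal_minors B"
proof -
  have sub: "maximal_minors B \<subseteq> maximal_minors (transpose_mat B)" for B :: "'a mat"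
  proof
    fix d assume "d \<in> maximal_minors B"
    then obtain X Y where XY: "d = det (submatrix B X Y)" "X \<subseteq> {..<dim_row B}" "Y \<subseteq> {..<dim_col B}"
      "card X = min (dim_row B) (dim_col B)" "card Y = min (dim_row B) (dim_col B)"
      by (auto simp: maximal_minors_def)
    let ?m = "min (dim_row B) (dim_col B)"
    have c: "card {i. i < dim_row B \<and> i \<in> X} = ?m" "card {i. i < dim_col B \<and> i \<in> Y} = ?m"
      using card_bounded_mem[OF XY(2)] card_bounded_mem[OF XY(3)] XY by simp_all
    have "submatrix (transpose_mat B) Y X = transpose_mat (submatrix B X Y)"
    proof (rule eq_matI)
      fix i j assume "i < dim_row (transpose_mat (submatrix B X Y))"
        "j < dim_col (transpose_mat (submatrix B X Y))"
      then have ij: "i < ?m" "j < ?m" using c by (auto simp: dim_submatrix)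
      have "pick Y i < dim_col B" "pick X j < dim_row B" using ij c by (auto intro!: pick_le)
      then show "submatrix (transpose_mat B) Y X $$ (i, j) = transpose_mat (submatrix B X Y) $$ (i, j)"
        using ij c by (simp add: submatrix_index dim_submatrix)
    qed (auto simp: dim_submatrix)
    moreover have "submatrix B X Y \<in> carrier_mat ?m ?m"
      using c by (auto simp: dim_submatrix)
    ultimately have "d = det (submatrix (transpose_mat B) Y X)"
      using XY(1) det_transpose by metis
    then show "d \<in> maximal_minors (transpose_mat B)"
      unfolding maximal_minors_def using XY by (auto simp: min.commute)
  qed
  show ?thesis using sub[of B] sub[of "transpose_mat B"] by auto
qed

section \<open>Left inverses of injective matrices\<close>

text \<open>Vectors of length \<open>k\<close> are modelled as polynomials of degree below
  \<open>k\<close>, which sit inside one vector space whatever the length. There an injective linear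
  map on a subspace has a linear left inverse, and \<open>K\<close> is read off from its values on
  monomials.\<close>

lemma inj_mat_left_inverse:
  fixes A :: "'a::field mat"
  assumes A: "A \<in> carrier_mat l k"
    and inj: "\<And>v. v \<in> carrier_vec k \<Longrightarrow> A *\<^sub>v v = 0\<^sub>v l \<Longrightarrow> v = 0\<^sub>v k"
  obtains K where "K \<in> carrier_mat k l" "K * A = 1\<^sub>m k"
proof -
  interpret vs: vector_space_pair "smult :: 'a \<Rightarrow> _" "smult :: 'a \<Rightarrow> _"
    by unfold_locales (simp_all add: smult_add_left smult_add_right)
  define V where "V = {f :: 'a poly. \<forall>i\<ge>k. coeff f i = 0}"
  define F where "F f = (\<Sum>r<l. monom (\<Sum>c<k. A $$ (r, c) * coeff f c) r)" for f
  have coeff_F: "coeff (F f) r = (if r < l then \<Sum>c<k. A $$ (r, c) * coeff f c else 0)" for f r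
    by (simp add: F_def coeff_sum)
  have F: "Vector_Spaces.linear smult smult F"
    unfolding Vector_Spaces.linear_iff
  proof (intro conjI allI)
    show "F (x + y) = F x + F y" for x y
      by (simp add: poly_eq_iff coeff_F distrib_left sum.distrib)
    show "F (smult c x) = smult c (F x)" for c x
      by (simp add: poly_eq_iff coeff_F sum_distrib_left mult_ac)
  qed (fact vs.vs1.vector_space_axioms)+
  have V: "vs.vs1.subspace V"
    by (rule vs.vs1.subspaceI) (auto simp: V_def)
  have "inj_on F V"
  proof (subst vs.linear_inj_on_iff_eq_0[OF F V], safe)
    fix f assume f: "f \<in> V" "F f = 0"
    have "A *\<^sub>v vec k (coeff f) = 0\<^sub>v l"
    proof (rule eq_vecI)
      fix r assume "r < dim_vec (0\<^sub>v l :: 'a vec)"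
      then show "(A *\<^sub>v vec k (coeff f)) $ r = 0\<^sub>v l $ r"
        using coeff_F[of f r] f(2) A by (simp add: scalar_prod_def lessThan_atLeast0)
    qed (use A in auto)
    then have "vec k (coeff f) = 0\<^sub>v k" by (intro inj) auto
    then have "coeff f i = 0" if "i < k" for i using that by (metis index_vec index_zero_vec(1))
    then show "f = 0" using f(1) by (auto simp: V_def poly_eq_iff) (meson not_less)
  qed
  then obtain g where g: "Vector_Spaces.linear smult smult g" "\<And>v. v \<in> V \<Longrightarrow> g (F v) = v"
    using vs.linear_exists_left_inverse_on[OF F V] by blast
  interpret g: Vector_Spaces.linear smult smult g by fact
  \<comment> \<open>Column \<open>r\<close> holds the first \<open>k\<close> coefficients of
    \<open>g\<close> at the \<open>r\<close>-th unit vector. Since \<open>F (monom 1 j)\<close> is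
    column \<open>j\<close> of \<open>A\<close>, the equation
    \<open>g (F (monom 1 j)) = monom 1 j\<close> is column \<open>j\<close> of
    \<open>?K * A = 1\<close>.\<close>
  let ?K = "mat k l (\<lambda>(i, r). coeff (g (monom 1 r)) i)"
  have "?K * A = 1\<^sub>m k"
  proof (rule eq_matI)
    fix i j assume "i < dim_row (1\<^sub>m k :: 'a mat)" "j < dim_col (1\<^sub>m k :: 'a mat)"
    then have ij: "i < k" "j < k" by auto
    have "F (monom 1 j) = (\<Sum>r<l. smult (A $$ (r, j)) (monom 1 r))"
      using ij by (simp add: F_def smult_monom if_distrib cong: if_cong)
    moreover have "g (F (monom 1 j)) = monom 1 j"
      using ij by (intro g(2)) (simp add: V_def)
    ultimately have "monom 1 j = (\<Sum>r<l. smult (A $$ (r, j)) (g (monom 1 r)))"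
      by (simp add: g.sum g.scale)
    then have "coeff (monom 1 j) i = (\<Sum>r<l. A $$ (r, j) * coeff (g (monom 1 r)) i)"
      by (simp add: coeff_sum)
    then show "(?K * A) $$ (i, j) = 1\<^sub>m k $$ (i, j)"
      using ij A by (auto simp: scalar_prod_def lessThan_atLeast0 mult.commute)
  qed (use A in auto)
  then show ?thesis using that[of ?K] by simp
qed

text \<open>If \<open>l < k\<close>, padding both matrices with zeros to size \<open>k\<close> keeps
  the product equal to 1, but the padded \<open>A\<close> has a zero row, so its determinant
  vanishes.\<close>

lemma left_inverse_mat_dim_le:
  fixes A K :: "'a::field mat"
  assumes A: "A \<in> carrier_mat l k" and K: "K \<in> carrier_mat k l" and KA: "K * A = 1\<^sub>m k"
  shows "k \<le> l"
proof (rule ccontr)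
  assume "\<not> k \<le> l"
  then have lk: "l < k" by simp
  let ?K = "mat k k (\<lambda>(i, j). if j < l then K $$ (i, j) else 0)"
  let ?A = "mat k k (\<lambda>(i, j). if i < l then A $$ (i, j) else 0)"
  have "?K * ?A = K * A"
  proof (rule eq_matI)
    fix i j assume "i < dim_row (K * A)" "j < dim_col (K * A)"
    then have ij: "i < k" "j < k" using A K by auto
    have "(?K * ?A) $$ (i, j) = (\<Sum>r\<in>{0..<k}. if r < l then K $$ (i, r) * A $$ (r, j) else 0)"
      using ij by (auto simp: scalar_prod_def intro!: sum.cong)
    also have "\<dots> = (\<Sum>r\<in>{0..<l}. K $$ (i, r) * A $$ (r, j))"
      by (rule sum.mono_neutral_cong_right) (use lk in auto)
    also have "\<dots> = (K * A) $$ (i, j)"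
      using ij A K by (auto simp: scalar_prod_def)
    finally show "(?K * ?A) $$ (i, j) = (K * A) $$ (i, j)" .
  qed (use A K in auto)
  then have "det ?K * det ?A = 1"
    using KA by (simp flip: det_mult[of _ k])
  moreover have "det ?A = 0"
  proof -
    have "det ?A = (\<Sum>j<k. ?A $$ (l, j) * cofactor ?A l j)"
      by (rule laplace_expansion_row) (use lk in auto)
    then show ?thesis using lk by simp
  qed
  ultimately show False by simp
qed

section \<open>Forms and homogeneous components\<close>

lemma pconst_0 [simp]: "pconst 0 = 0"
  by (simp add: pconst_def)

lemma pconst_1 [simp]: "pconst 1 = 1"
  by (simp add: pconst_def)

lemma pconst_add: "pconst (a + b) = pconst a + pconst b"
  by (simp add: pconst_def single_add)

lemma pconst_diff: "pconst (a - b :: 'k::comm_ring_1) = pconst a - pconst b"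
  by (simp add: pconst_def single_diff)

lemma pconst_mult: "pconst (a * b) = pconst a * (pconst b :: ('v, 'k::comm_ring_1) mpol)"
  by (simp add: pconst_def mult_single)

lemma pconst_sum: "pconst (\<Sum>x\<in>A. f x) = (\<Sum>x\<in>A. pconst (f x))"
  by (induction A rule: infinite_finite_induct) (simp_all add: pconst_add)

text \<open>Through this, matrix identities over the field carry over to the coordinate ring by
  \<open>map_mat pconst\<close>.\<close>

interpretation pconst: semiring_hom "pconst :: 'k::comm_ring_1 \<Rightarrow> ('v, 'k) mpol"
  by unfold_locales (simp_all add: pconst_add pconst_mult)

abbreviation mdeg :: "('n::finite \<Rightarrow>\<^sub>0 nat) \<Rightarrow> nat" where
  "mdeg m \<equiv> \<Sum>i\<in>UNIV. Poly_Mapping.lookup m i"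

lemma mdeg_add: "mdeg (m + m') = mdeg m + mdeg m'"
  by (simp add: lookup_add sum.distrib)

lemma mdeg_single: "mdeg (Poly_Mapping.single i n) = n"
  by (simp add: lookup_single when_def)

lemma forms_0: "0 \<in> forms d"
  by (simp add: forms_def)

lemma forms_single: "mdeg m = d \<Longrightarrow> Poly_Mapping.single m c \<in> forms d"
  by (simp add: forms_def)

lemma forms_add: "p \<in> forms d \<Longrightarrow> q \<in> forms d \<Longrightarrow> p + q \<in> forms d"
  using keys_add[of p q] by (auto simp: forms_def)

lemma forms_sum: "(\<And>x. x \<in> A \<Longrightarrow> f x \<in> forms d) \<Longrightarrow> sum f A \<in> forms d"
  by (induction A rule: infinite_finite_induct) (auto simp: forms_0 forms_add)

lemma forms_mult:
  fixes p q :: "('n::finite, 'k::comm_ring_1) mpol"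
  assumes "p \<in> forms a" "q \<in> forms b"
  shows "p * q \<in> forms (a + b)"
proof -
  have "mdeg m = a + b" if m: "m \<in> Poly_Mapping.keys (p * q)" for m
  proof -
    obtain x y where "m = x + y" "x \<in> Poly_Mapping.keys p" "y \<in> Poly_Mapping.keys q"
      using m keys_mult[of p q] by blast
    then show ?thesis using assms by (auto simp: forms_def mdeg_add)
  qed
  then show ?thesis by (simp add: forms_def)
qed

lemma forms_pconst: "pconst c \<in> forms 0"
  by (auto simp: pconst_def intro: forms_single)

lemma forms_pconst_mult:
  fixes p :: "('n::finite, 'k::comm_ring_1) mpol"
  shows "p \<in> forms d \<Longrightarrow> pconst c * p \<in> forms d"
  using forms_mult[OF forms_pconst, of p d c] by simp

lemma forms_pvar: "pvar i \<in> forms 1"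
  unfolding pvar_def by (rule forms_single, rule mdeg_single)

lemma forms_quad_monom: "quad_monom u \<in> forms 2"
proof (cases u)
  case (Upair i j)
  then show ?thesis
    using forms_mult[OF forms_pvar forms_pvar, of i j] by (simp add: quad_monom_Upair numeral_2_eq_2)
qed

lemma forms_lin_comb: "set bs \<subseteq> forms d \<Longrightarrow> lin_comb bs v \<in> forms d"
  unfolding lin_comb_def by (intro forms_sum forms_pconst_mult) auto

lemma mpol_sum_monomials:
  fixes p :: "('v, 'k::comm_monoid_add) mpol"
  shows "p = (\<Sum>m\<in>Poly_Mapping.keys p. Poly_Mapping.single m (Poly_Mapping.lookup p m))"
  by (rule poly_mapping_eqI)
    (auto simp: lookup_sum lookup_single when_def in_keys_iff sum.delta')

lemma mpol_induct [case_names monomial add]: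
  fixes p :: "('v, 'k::comm_monoid_add) mpol"
  assumes mon: "\<And>m c. P (Poly_Mapping.single m c)"
    and add: "\<And>p q. P p \<Longrightarrow> P q \<Longrightarrow> P (p + q)"
  shows "P p"
proof -
  have "P (\<Sum>m\<in>A. Poly_Mapping.single m (c m))" for A c
    by (induction A rule: infinite_finite_induct) (use mon[of 0 0] mon add in auto)
  then show ?thesis using mpol_sum_monomials[of p] by metis
qed

lift_definition hom_comp :: "nat \<Rightarrow> ('n::finite, 'k::zero) mpol \<Rightarrow> ('n, 'k) mpol"
  is "\<lambda>d p m. if mdeg m = d then p m else 0"
  by (rule finite_subset) auto

lemma lookup_hom_comp:
  "Poly_Mapping.lookup (hom_comp d p) m = (if mdeg m = d then Poly_Mapping.lookup p m else 0)"
  by transfer simp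

lemma hom_comp_0 [simp]: "hom_comp d 0 = 0"
  by (rule poly_mapping_eqI) (simp add: lookup_hom_comp)

lemma hom_comp_add: "hom_comp d (p + q) = hom_comp d p + hom_comp d q"
  by (rule poly_mapping_eqI) (simp add: lookup_hom_comp lookup_add)

lemma hom_comp_diff:
  fixes p q :: "('n::finite, 'k::comm_ring_1) mpol"
  shows "hom_comp d (p - q) = hom_comp d p - hom_comp d q"
  by (rule poly_mapping_eqI) (simp add: lookup_hom_comp lookup_minus)

lemma hom_comp_single:
  "hom_comp d (Poly_Mapping.single m c) = (if mdeg m = d then Poly_Mapping.single m c else 0)"
  by (rule poly_mapping_eqI) (auto simp: lookup_hom_comp lookup_single when_def)

lemma hom_comp_form: "p \<in> forms a \<Longrightarrow> hom_comp d p = (if a = d then p else 0)"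
  by (rule poly_mapping_eqI) (auto simp: lookup_hom_comp forms_def in_keys_iff)

lemma hom_comp_monomial_mult:
  fixes p :: "('n::finite, 'k::comm_ring_1) mpol"
  shows "hom_comp d (Poly_Mapping.single m c * p) =
    (if mdeg m \<le> d then Poly_Mapping.single m c * hom_comp (d - mdeg m) p else 0)"
proof (induction p rule: mpol_induct)
  case (monomial m' c')
  show ?case by (auto simp: mult_single hom_comp_single mdeg_add)
next
  case (add p q)
  then show ?case by (simp add: distrib_left hom_comp_add)
qed

text \<open>The polynomials all of whose components lie in \<open>I\<close> form an ideal, since
  multiplying by a monomial only shifts degrees. It contains the homogeneous generators, hence all
  of \<open>I\<close>.\<close>

lemma homogeneous_ideal_hom_comp:
  fixes I :: "('n::finite, 'k::comm_ring_1) mpol set"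
  assumes "homogeneous_ideal I" "p \<in> I"
  shows "hom_comp d p \<in> I"
proof -
  obtain G where G: "G \<subseteq> (\<Union>d. forms d)" "I = ideal_gen G"
    using assms(1) by (auto simp: homogeneous_ideal_def)
  let ?T = "{p. \<forall>d. hom_comp d p \<in> I}"
  have I0: "0 \<in> I" and I_add: "\<And>x y. x \<in> I \<Longrightarrow> y \<in> I \<Longrightarrow> x + y \<in> I"
    and I_mult: "\<And>c x. x \<in> I \<Longrightarrow> c * x \<in> I"
    unfolding G(2) by (auto intro: ideal.span_zero ideal.span_add ideal.span_scale)
  have "hom_comp d (r * p) \<in> I" if "p \<in> ?T" for r p d
    using that
  proof (induction r rule: mpol_induct)
    case (monomial m c)
    then show ?case by (simp add: hom_comp_monomial_mult I0 I_mult)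
  next
    case (add a b)
    then show ?case by (simp add: distrib_right hom_comp_add I_add)
  qed
  then have "is_ideal ?T"
    by (intro ideal.subspaceI) (auto simp: I0 I_add hom_comp_add)
  moreover have "G \<subseteq> ?T"
  proof safe
    fix g d assume "g \<in> G"
    moreover from this obtain a where "g \<in> forms a" using G(1) by auto
    ultimately show "hom_comp d g \<in> I"
      using G(2) I0 by (simp add: hom_comp_form ideal.span_base)
  qed
  ultimately have "I \<subseteq> ?T" unfolding G(2) by (intro ideal.span_minimal) auto
  then show ?thesis using assms(2) by auto
qed

lemma homogeneous_ideal_is_ideal: "homogeneous_ideal I \<Longrightarrow> is_ideal I"
  by (auto simp: homogeneous_ideal_def ideal.subspace_span)

lemma monomial_Suc:
  fixes c :: "'k::comm_ring_1"
  assumes "mdeg m = Suc d"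
  obtains i m' where "mdeg m' = d" "Poly_Mapping.single m c = pvar i * Poly_Mapping.single m' c"
proof -
  obtain i where i: "Poly_Mapping.lookup m i > 0"
    using assms by (metis gr0I nat.distinct(1) sum.neutral)
  define m' where "m' = m - Poly_Mapping.single i 1"
  have m: "m = Poly_Mapping.single i 1 + m'"
    unfolding m'_def
    by (rule poly_mapping_eqI) (use i in \<open>auto simp: lookup_add lookup_minus lookup_single when_def\<close>)
  have "mdeg m = mdeg (Poly_Mapping.single i 1) + mdeg m'"
    by (subst m) (rule mdeg_add)
  then have "mdeg m' = d" using assms by (simp only: mdeg_single)
  moreover have "Poly_Mapping.single m c = pvar i * Poly_Mapping.single m' c"
    using m by (simp add: pvar_def mult_single)
  ultimately show ?thesis using that by blast
qed

section \<open>Matrices of multiplication maps and of the Gorenstein pairing\<close>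

lemma lin_comb_diff:
  fixes v w :: "'k::comm_ring_1 vec"
  assumes "v \<in> carrier_vec (length bs)" "w \<in> carrier_vec (length bs)"
  shows "lin_comb bs (v - w) = lin_comb bs v - lin_comb bs w"
  using assms by (simp add: lin_comb_def pconst_diff left_diff_distrib sum_subtractf)

lemma coords_eqI:
  fixes I :: "('n::finite, 'k::comm_ring_1) mpol set"
  assumes I: "is_ideal I" and b: "basis_mod I d bs"
    and v: "v \<in> carrier_vec (length bs)" "p - lin_comb bs v \<in> I"
  shows "coords I bs p = v"
  unfolding coords_def
proof (rule the_equality)
  fix w assume w: "w \<in> carrier_vec (length bs) \<and> p - lin_comb bs w \<in> I"
  have "lin_comb bs (w - v) = (p - lin_comb bs v) - (p - lin_comb bs w)"
    using w v by (simp add: lin_comb_diff)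
  then have "lin_comb bs (w - v) \<in> I"
    using ideal.subspace_diff[OF I] w v by metis
  then have "w - v = 0\<^sub>v (length bs)"
    using b w v by (auto simp: basis_mod_def)
  then show "w = v"
    using w v by (metis (no_types, lifting) carrier_vecD eq_iff_diff_eq_0 eq_vecI index_minus_vec(1) index_zero_vec(1))
qed (use v in auto)

lemma coords:
  fixes I :: "('n::finite, 'k::comm_ring_1) mpol set"
  assumes I: "is_ideal I" and b: "basis_mod I d bs" and p: "p \<in> forms d"
  shows "coords I bs p \<in> carrier_vec (length bs)" "p - lin_comb bs (coords I bs p) \<in> I"
proof -
  obtain v where "v \<in> carrier_vec (length bs)" "p - lin_comb bs v \<in> I"
    using b p by (auto simp: basis_mod_def)
  then show "coords I bs p \<in> carrier_vec (length bs)" "p - lin_comb bs (coords I bs p) \<in> I"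
    using coords_eqI[OF I b] by auto
qed

text \<open>Linearity of coordinates in the form used for matrix products: \<open>x\<close> need
  only be congruent to the combination modulo \<open>I\<close>, so products may be replaced by their
  expansions in a basis.\<close>

lemma coords_sum:
  fixes I :: "('n::finite, 'k::comm_ring_1) mpol set"
  assumes I: "is_ideal I" and b: "basis_mod I d bs" and p: "\<And>s. s < n \<Longrightarrow> p s \<in> forms d"
    and x: "x - (\<Sum>s<n. pconst (w s) * p s) \<in> I"
  shows "coords I bs x = vec (length bs) (\<lambda>r. \<Sum>s<n. w s * coords I bs (p s) $ r)" (is "_ = ?v")
proof (rule coords_eqI[OF I b])
  have "lin_comb bs ?v = (\<Sum>j<length bs. \<Sum>s<n. pconst (w s) * (pconst (coords I bs (p s) $ j) * bs ! j))"
    by (simp add: lin_comb_def pconst_sum pconst_mult sum_distrib_right mult.assoc)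
  also have "\<dots> = (\<Sum>s<n. pconst (w s) * lin_comb bs (coords I bs (p s)))"
    by (subst sum.swap) (simp add: lin_comb_def sum_distrib_left)
  finally have "x - lin_comb bs ?v = (x - (\<Sum>s<n. pconst (w s) * p s)) +
      (\<Sum>s<n. pconst (w s) * (p s - lin_comb bs (coords I bs (p s))))"
    by (simp add: right_diff_distrib sum_subtractf)
  also have "\<dots> \<in> I"
    by (intro ideal.subspace_add[OF I] ideal.subspace_sum[OF I] ideal.subspace_scale[OF I] x
        coords(2)[OF I b] p) auto
  finally show "x - lin_comb bs ?v \<in> I" .
qed simp

definition mult_mat ::
    "('n::finite, 'k::comm_ring_1) mpol set \<Rightarrow> ('n, 'k) mpol list \<Rightarrow> ('n, 'k) mpol list \<Rightarrow>
     ('n, 'k) mpol \<Rightarrow> 'k mat" where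
  "mult_mat I bs bs' f = mat (length bs') (length bs) (\<lambda>(r, c). coords I bs' (f * bs ! c) $ r)"

lemma mult_mat_carrier [simp]: "mult_mat I bs bs' f \<in> carrier_mat (length bs') (length bs)"
  by (simp add: mult_mat_def)

lemma basis_mod_nth: "basis_mod I d bs \<Longrightarrow> c < length bs \<Longrightarrow> bs ! c \<in> forms d"
  by (auto simp: basis_mod_def)

text \<open>Column \<open>c\<close> expands \<open>f * bs ! c\<close> in \<open>bs'\<close> modulo
  \<open>I\<close>; multiplying the expansion by \<open>g\<close> and applying
  \<open>coords_sum\<close> gives the matrix product. Degrees are written as nested sums to fit
  \<open>forms_mult\<close>.\<close>

lemma mult_mat_mult:
  fixes I :: "('n::finite, 'k::comm_ring_1) mpol set"
  assumes I: "is_ideal I" and b: "basis_mod I d bs" and b': "basis_mod I (a + d) bs'"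
    and b'': "basis_mod I (a' + (a + d)) bs''"
    and f: "f \<in> forms a" and g: "g \<in> forms a'"
  shows "mult_mat I bs' bs'' g * mult_mat I bs bs' f = mult_mat I bs bs'' (g * f)"
proof (rule eq_matI)
  fix r c assume "r < dim_row (mult_mat I bs bs'' (g * f))" "c < dim_col (mult_mat I bs bs'' (g * f))"
  then have rc: "r < length bs''" "c < length bs" by (auto simp: mult_mat_def)
  define w where "w = coords I bs' (f * bs ! c)"
  have fb: "f * bs ! c \<in> forms (a + d)" by (intro forms_mult f basis_mod_nth[OF b] rc)
  have "g * f * bs ! c - (\<Sum>s<length bs'. pconst (w $ s) * (g * bs' ! s)) =
      g * (f * bs ! c - lin_comb bs' w)"
    by (simp add: lin_comb_def right_diff_distrib sum_distrib_left mult_ac)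
  also have "\<dots> \<in> I"
    unfolding w_def by (intro ideal.subspace_scale[OF I] coords(2)[OF I b' fb])
  finally have "coords I bs'' (g * f * bs ! c) =
      vec (length bs'') (\<lambda>r. \<Sum>s<length bs'. w $ s * coords I bs'' (g * bs' ! s) $ r)"
    by (intro coords_sum[OF I b''] forms_mult g basis_mod_nth[OF b'])
  then show "(mult_mat I bs' bs'' g * mult_mat I bs bs' f) $$ (r, c) = mult_mat I bs bs'' (g * f) $$ (r, c)"
    using rc by (simp add: mult_mat_def scalar_prod_def w_def lessThan_atLeast0 mult.commute)
qed (simp_all add: mult_mat_def)

lemma mult_mat_inj:
  fixes I :: "('n::finite, 'k::comm_ring_1) mpol set"
  assumes I: "is_ideal I" and b: "basis_mod I d bs" and b': "basis_mod I (a + d) bs'"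
    and f: "f \<in> forms a" and inj: "\<And>p. p \<in> forms d \<Longrightarrow> f * p \<in> I \<Longrightarrow> p \<in> I"
    and v: "v \<in> carrier_vec (length bs)" "mult_mat I bs bs' f *\<^sub>v v = 0\<^sub>v (length bs')"
  shows "v = 0\<^sub>v (length bs)"
proof -
  let ?x = "f * lin_comb bs v"
  have lc: "lin_comb bs v \<in> forms d" using b by (intro forms_lin_comb) (simp add: basis_mod_def)
  have "?x - (\<Sum>s<length bs. pconst (v $ s) * (f * bs ! s)) = 0"
    by (simp add: lin_comb_def sum_distrib_left mult_ac)
  then have "coords I bs' ?x = vec (length bs') (\<lambda>r. \<Sum>s<length bs. v $ s * coords I bs' (f * bs ! s) $ r)"
    by (intro coords_sum[OF I b'] forms_mult f basis_mod_nth[OF b]) (auto simp: ideal.subspace_0[OF I])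
  also have "\<dots> = mult_mat I bs bs' f *\<^sub>v v"
    using v(1) by (intro eq_vecI) (auto simp: mult_mat_def scalar_prod_def lessThan_atLeast0 mult.commute)
  finally have "coords I bs' ?x = 0\<^sub>v (length bs')" using v by simp
  then have "?x \<in> I"
    using coords(2)[OF I b' forms_mult[OF f lc]] by (simp add: lin_comb_def)
  then have "lin_comb bs v \<in> I" using inj lc by blast
  then show ?thesis using b v by (simp add: basis_mod_def)
qed

section \<open>The socle pairing\<close>

text \<open>The Gram matrix of the multiplication pairing into the top degree, which the basis
  \<open>[t]\<close> identifies with the field.\<close>

definition pairing_mat ::
    "('n::finite, 'k::comm_ring_1) mpol set \<Rightarrow> ('n, 'k) mpol \<Rightarrow> ('n, 'k) mpol list \<Rightarrow>
     ('n, 'k) mpol list \<Rightarrow> 'k mat" where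
  "pairing_mat I t bs bs' =
     mat (length bs) (length bs') (\<lambda>(r, c). coords I [t] (bs ! r * bs' ! c) $ 0)"

lemma pairing_mat_carrier [simp]: "pairing_mat I t bs bs' \<in> carrier_mat (length bs) (length bs')"
  by (simp add: pairing_mat_def)

lemma pairing_mat_transpose: "transpose_mat (pairing_mat I t bs bs') = pairing_mat I t bs' bs"
  by (rule eq_matI) (auto simp: pairing_mat_def mult.commute)

text \<open>The right-hand side, the coefficient of \<open>t\<close> in \<open>f * x * y\<close>,
  treats the two bases alike. Exchanging them therefore yields the self-adjointness in the next
  lemma.\<close>

lemma mult_mat_pairing_mat:
  fixes I :: "('n::finite, 'k::comm_ring_1) mpol set"
  assumes I: "is_ideal I" and t: "basis_mod I (a + d + d') [t]"
    and b: "basis_mod I d bs" and b1: "basis_mod I (a + d) bs1" and b': "basis_mod I d' bs'"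
    and f: "f \<in> forms a"
  shows "transpose_mat (mult_mat I bs bs1 f) * pairing_mat I t bs1 bs' =
    mat (length bs) (length bs') (\<lambda>(r, c). coords I [t] (f * (bs ! r * bs' ! c)) $ 0)" (is "?A = ?B")
proof (rule eq_matI)
  fix r c assume "r < dim_row ?B" "c < dim_col ?B"
  then have rc: "r < length bs" "c < length bs'" by auto
  define w where "w = coords I bs1 (f * bs ! r)"
  have fb: "f * bs ! r \<in> forms (a + d)" by (intro forms_mult f basis_mod_nth[OF b] rc)
  have "f * (bs ! r * bs' ! c) - (\<Sum>s<length bs1. pconst (w $ s) * (bs1 ! s * bs' ! c)) =
      bs' ! c * (f * bs ! r - lin_comb bs1 w)"
    by (simp add: lin_comb_def right_diff_distrib sum_distrib_left mult_ac)
  also have "\<dots> \<in> I"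
    unfolding w_def by (intro ideal.subspace_scale[OF I] coords(2)[OF I b1 fb])
  finally have "coords I [t] (f * (bs ! r * bs' ! c)) =
      vec (length [t]) (\<lambda>k. \<Sum>s<length bs1. w $ s * coords I [t] (bs1 ! s * bs' ! c) $ k)"
    by (intro coords_sum[OF I t] forms_mult basis_mod_nth[OF b1] basis_mod_nth[OF b'] rc)
  then show "?A $$ (r, c) = ?B $$ (r, c)"
    using rc by (simp add: pairing_mat_def mult_mat_def scalar_prod_def w_def lessThan_atLeast0)
qed (auto simp: pairing_mat_def mult_mat_def)

text \<open>Multiplication by \<open>f\<close> is self-adjoint:
  \<open>(f * x) * y = x * (f * y)\<close>.\<close>

lemma pairing_mat_mult_mat:
  fixes I :: "('n::finite, 'k::comm_ring_1) mpol set"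
  assumes I: "is_ideal I" and t: "basis_mod I (a + d + d') [t]"
    and b: "basis_mod I d bs" and b1: "basis_mod I (a + d) bs1"
    and b': "basis_mod I d' bs'" and b1': "basis_mod I (a + d') bs1'"
    and f: "f \<in> forms a"
  shows "pairing_mat I t bs' bs1 * mult_mat I bs bs1 f =
    transpose_mat (mult_mat I bs' bs1' f) * pairing_mat I t bs1' bs"
proof -
  have t': "basis_mod I (a + d' + d) [t]" using t by (simp add: ac_simps)
  have "pairing_mat I t bs' bs1 * mult_mat I bs bs1 f =
      transpose_mat (transpose_mat (mult_mat I bs bs1 f) * pairing_mat I t bs1 bs')"
    by (subst transpose_mult[of _ "length bs" "length bs1" _ "length bs'"])
      (simp_all add: pairing_mat_transpose)
  also have "\<dots> = transpose_mat (mult_mat I bs' bs1' f) * pairing_mat I t bs1' bs"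
    unfolding mult_mat_pairing_mat[OF I t b b1 b' f] mult_mat_pairing_mat[OF I t' b' b1' b f]
    by (rule eq_matI) (auto simp: mult.commute)
  finally show ?thesis .
qed

section \<open>Matrices of linear forms\<close>

text \<open>A matrix of linear forms given by one scalar matrix for each variable, so that products
  with scalar matrices can be computed for each variable separately.\<close>

definition linear_mat :: "nat \<Rightarrow> nat \<Rightarrow> ('u::finite \<Rightarrow> 'k::comm_ring_1 mat) \<Rightarrow> ('u, 'k) mpol mat" where
  "linear_mat nr nc F = mat nr nc (\<lambda>(r, c). \<Sum>u\<in>UNIV. pconst (F u $$ (r, c)) * pvar u)"

lemma linear_mat_carrier [simp]: "linear_mat nr nc F \<in> carrier_mat nr nc"
  by (simp add: linear_mat_def)

lemma linear_mat_transpose: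
  assumes "\<And>u. F u \<in> carrier_mat nr nc"
  shows "transpose_mat (linear_mat nr nc F) = linear_mat nc nr (\<lambda>u. transpose_mat (F u))"
proof -
  have [simp]: "dim_row (F u) = nr" "dim_col (F u) = nc" for u using assms[of u] by auto
  show ?thesis by (rule eq_matI) (auto simp: linear_mat_def)
qed

lemma linear_mat_mult_left:
  fixes F :: "'u::finite \<Rightarrow> 'k::comm_ring_1 mat"
  assumes F: "\<And>u. F u \<in> carrier_mat n nc" and A: "A \<in> carrier_mat nr n"
  shows "map_mat pconst A * linear_mat n nc F = linear_mat nr nc (\<lambda>u. A * F u)"
proof (rule eq_matI)
  fix r c assume "r < dim_row (linear_mat nr nc (\<lambda>u. A * F u))" "c < dim_col (linear_mat nr nc (\<lambda>u. A * F u))"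
  then have rc: "r < nr" "c < nc" by (auto simp: linear_mat_def)
  have "(map_mat pconst A * linear_mat n nc F) $$ (r, c) =
      (\<Sum>s=0..<n. \<Sum>u\<in>UNIV. pconst (A $$ (r, s)) * (pconst (F u $$ (s, c)) * pvar u))"
    using rc A by (simp add: linear_mat_def scalar_prod_def sum_distrib_left)
  also have "\<dots> = (\<Sum>u\<in>UNIV. pconst (\<Sum>s=0..<n. A $$ (r, s) * F u $$ (s, c)) * pvar u)"
    by (subst sum.swap) (simp add: pconst_sum pconst_mult sum_distrib_right mult.assoc)
  also have "\<dots> = (\<Sum>u\<in>UNIV. pconst ((A * F u) $$ (r, c)) * pvar u)"
  proof (rule sum.cong[OF refl])
    fix u :: 'u
    show "pconst (\<Sum>s=0..<n. A $$ (r, s) * F u $$ (s, c)) * pvar u = pconst ((A * F u) $$ (r, c)) * pvar u"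
      using rc F[of u] A by (simp add: scalar_prod_def)
  qed
  finally show "(map_mat pconst A * linear_mat n nc F) $$ (r, c) = linear_mat nr nc (\<lambda>u. A * F u) $$ (r, c)"
    using rc by (simp add: linear_mat_def)
qed (use A in \<open>auto simp: linear_mat_def\<close>)

lemma linear_mat_mult_right:
  assumes F: "\<And>u. F u \<in> carrier_mat nr n" and A: "A \<in> carrier_mat n nc"
  shows "linear_mat nr n F * map_mat pconst A = linear_mat nr nc (\<lambda>u. F u * A)"
proof -
  have "linear_mat nr n F * map_mat pconst A =
      transpose_mat (map_mat pconst (transpose_mat A) * transpose_mat (linear_mat nr n F))"
    using A by (subst transpose_mult[of _ nc n _ nr]) (simp_all add: map_mat_transpose[symmetric])
  also have "\<dots> = transpose_mat (linear_mat nc nr (\<lambda>u. transpose_mat A * transpose_mat (F u)))"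
    using F A by (simp add: linear_mat_transpose linear_mat_mult_left)
  also have "\<dots> = linear_mat nr nc (\<lambda>u. transpose_mat (transpose_mat A * transpose_mat (F u)))"
    using F A by (intro linear_mat_transpose) auto
  also have "\<dots> = linear_mat nr nc (\<lambda>u. F u * A)"
    using F A by (simp add: transpose_mult[of _ nc n _ nr])
  finally show ?thesis .
qed

lemma generic_quadric_mat_eq:
  "generic_quadric_mat I bs bs' =
     linear_mat (length bs') (length bs) (\<lambda>u. mult_mat I bs bs' (quad_monom u))"
  by (rule eq_matI) (auto simp: generic_quadric_mat_def linear_mat_def mult_mat_def)

lemma inj_graded_mult:
  fixes I :: "('n::finite, 'k::field) mpol set"
  assumes I: "is_ideal I" and b: "basis_mod I d bs" and b': "basis_mod I (a + d) bs'"
    and f: "f \<in> forms a" and inj: "\<And>p. p \<in> forms d \<Longrightarrow> f * p \<in> I \<Longrightarrow> p \<in> I"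
  obtains K where "K \<in> carrier_mat (length bs) (length bs')"
    "K * mult_mat I bs bs' f = 1\<^sub>m (length bs)" "length bs \<le> length bs'"
proof -
  obtain K where K: "K \<in> carrier_mat (length bs) (length bs')"
    "K * mult_mat I bs bs' f = 1\<^sub>m (length bs)"
    by (rule inj_mat_left_inverse[OF mult_mat_carrier mult_mat_inj[OF I b b' f inj]])
  then show ?thesis using that left_inverse_mat_dim_le[OF mult_mat_carrier] by blast
qed

section \<open>Gorenstein algebras\<close>

locale gorenstein_algebra =
  fixes I :: "('n::finite, 'k::field) mpol set"
    and bas :: "nat \<Rightarrow> ('n, 'k) mpol list"
    and e :: nat
  assumes homogeneous: "homogeneous_ideal I"
    and gorenstein: "gorenstein_artinian I"
    and socle_deg: "socle_degree I e"
    and basis: "basis_mod I i (bas i)"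
begin

lemma is_ideal_I: "is_ideal I"
  using homogeneous by (rule homogeneous_ideal_is_ideal)

lemmas I_0 = ideal.subspace_0[OF is_ideal_I]
  and I_add = ideal.subspace_add[OF is_ideal_I]
  and I_diff = ideal.subspace_diff[OF is_ideal_I]
  and I_sum = ideal.subspace_sum[OF is_ideal_I]
  and I_mult = ideal.subspace_scale[OF is_ideal_I]

lemma forms_gt_subset: "d > e \<Longrightarrow> forms d \<subseteq> I"
  using socle_deg by (simp add: socle_degree_def)

lemma forms_top_socle: "forms e \<subseteq> socle I"
proof
  fix p :: "('n, 'k) mpol" assume "p \<in> forms e"
  then have "pvar i * p \<in> forms (1 + e)" for i by (intro forms_mult forms_pvar)
  then show "p \<in> socle I" using forms_gt_subset[of "1 + e"] by (auto simp: socle_def)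
qed

text \<open>Degree \<open>e\<close> lies in the socle and is nonzero in the algebra, so any nonzero
  class of degree \<open>e\<close> spans the one-dimensional socle.\<close>

lemma socle_generator:
  obtains t where "t \<in> forms e" "t \<notin> I" "\<And>p. p \<in> socle I \<Longrightarrow> \<exists>c. p - pconst c * t \<in> I"
proof -
  obtain t where t: "t \<in> forms e" "t \<notin> I"
    using socle_deg by (auto simp: socle_degree_def)
  obtain s where s: "\<And>p. p \<in> socle I \<Longrightarrow> \<exists>c. p - pconst c * s \<in> I"
    using gorenstein by (auto simp: gorenstein_artinian_def)
  obtain a where a: "t - pconst a * s \<in> I" using s t forms_top_socle by blast
  have "a \<noteq> 0" using a t by auto
  have "\<exists>c. p - pconst c * t \<in> I" if p: "p \<in> socle I" for p
  proof -
    obtain c where c: "p - pconst c * s \<in> I" using s[OF p] by blast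
    have "pconst (c / a) * pconst a = (pconst c :: ('n, 'k) mpol)"
      using \<open>a \<noteq> 0\<close> by (simp flip: pconst_mult)
    then have "p - pconst (c / a) * t = (p - pconst c * s) - pconst (c / a) * (t - pconst a * s)"
      by (simp add: right_diff_distrib flip: mult.assoc)
    also have "\<dots> \<in> I" by (intro I_diff I_mult a c)
    finally show ?thesis by blast
  qed
  then show ?thesis using that t by blast
qed

text \<open>The element is congruent to a multiple of a form \<open>t\<close> of degree
  \<open>e\<close>. As \<open>d < e\<close>, the degree \<open>d\<close> component of that
  congruence is \<open>p\<close> itself.\<close>

lemma socle_below_top:
  assumes "p \<in> forms d" "d < e" "p \<in> socle I"
  shows "p \<in> I"
proof -
  obtain t where t: "t \<in> forms e" "\<And>p. p \<in> socle I \<Longrightarrow> \<exists>c. p - pconst c * t \<in> I"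
    using socle_generator by metis
  obtain c where "p - pconst c * t \<in> I" using t(2) assms(3) by blast
  then have "hom_comp d (p - pconst c * t) \<in> I"
    by (rule homogeneous_ideal_hom_comp[OF homogeneous])
  then show ?thesis
    using assms(2) by (simp add: hom_comp_diff hom_comp_form[OF assms(1)]
        hom_comp_form[OF forms_pconst_mult[OF t(1)]])
qed

text \<open>By induction on \<open>a\<close>: each \<open>pvar i * q\<close> pairs to zero with
  degree \<open>a\<close>, hence lies in \<open>I\<close>. So \<open>q\<close> is a socle element
  below the top degree and vanishes. For \<open>a = 0\<close>, pair with 1.\<close>

lemma pairing_nondegenerate:
  assumes "a + d = e" "q \<in> forms d" "\<And>p. p \<in> forms a \<Longrightarrow> p * q \<in> I"
  shows "q \<in> I"
  using assms
proof (induction a arbitrary: d q)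
  case 0
  show ?case using 0(3)[OF forms_pconst[of 1]] by simp
next
  case (Suc a)
  have "pvar i * q \<in> I" for i
  proof (rule Suc.IH[of "1 + d"])
    show "pvar i * q \<in> forms (1 + d)" by (intro forms_mult forms_pvar Suc.prems)
    fix p :: "('n, 'k) mpol" assume p: "p \<in> forms a"
    then have "pvar i * p * q \<in> I"
      using forms_mult[OF forms_pvar p] by (intro Suc.prems(3)) simp
    then show "p * (pvar i * q) \<in> I" by (simp add: mult_ac)
  qed (use Suc.prems in simp)
  then show ?case
    using socle_below_top Suc.prems by (auto simp: socle_def)
qed

lemma basis_mod_top:
  obtains t where "basis_mod I e [t]"
proof -
  obtain t where t: "t \<in> forms e" "t \<notin> I" "\<And>p. p \<in> socle I \<Longrightarrow> \<exists>c. p - pconst c * t \<in> I"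
    using socle_generator by blast
  have lc: "lin_comb [t] v = pconst (v $ 0) * t" for v by (simp add: lin_comb_def)
  have "v = 0\<^sub>v 1" if v: "v \<in> carrier_vec 1" "pconst (v $ 0) * t \<in> I" for v
  proof (rule ccontr)
    assume "v \<noteq> 0\<^sub>v 1"
    then have "v $ 0 \<noteq> 0" using v(1) by auto
    then have "pconst (inverse (v $ 0)) * (pconst (v $ 0) * t) = t"
      by (simp add: mult.assoc[symmetric] flip: pconst_mult)
    then show False using I_mult[OF v(2), of "pconst (inverse (v $ 0))"] t by simp
  qed
  moreover have "\<exists>v\<in>carrier_vec 1. p - pconst (v $ 0) * t \<in> I" if "p \<in> forms e" for p
  proof -
    have "p \<in> socle I" using that forms_top_socle by blast
    then obtain c where "p - pconst c * t \<in> I" using t(3) by blast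
    then show ?thesis by (intro bexI[of _ "vec 1 (\<lambda>_. c)"]) auto
  qed
  ultimately have "basis_mod I e [t]" using t by (simp add: basis_mod_def lc)
  then show ?thesis by (rule that)
qed

text \<open>A kernel vector gives a form \<open>q\<close> annihilated by a basis of degree
  \<open>a\<close>, hence by all of degree \<open>a\<close>; nondegeneracy forces it to be
  zero.\<close>

lemma pairing_mat_left_inverse:
  assumes t: "basis_mod I e [t]" and e: "a + d = e"
  obtains K where "K \<in> carrier_mat (length (bas d)) (length (bas a))"
    "K * pairing_mat I t (bas a) (bas d) = 1\<^sub>m (length (bas d))"
proof (rule inj_mat_left_inverse[OF pairing_mat_carrier])
  fix v assume v: "v \<in> carrier_vec (length (bas d))"
    "pairing_mat I t (bas a) (bas d) *\<^sub>v v = 0\<^sub>v (length (bas a))"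
  define q where "q = lin_comb (bas d) v"
  have q: "q \<in> forms d"
    using basis[of d] unfolding q_def by (intro forms_lin_comb) (simp add: basis_mod_def)
  have bq: "bas a ! r * q \<in> I" if r: "r < length (bas a)" for r
  proof -
    have bqf: "bas a ! r * bas d ! s \<in> forms e" if "s < length (bas d)" for s
      unfolding e[symmetric] using r that by (intro forms_mult basis_mod_nth[OF basis])
    have "bas a ! r * q - (\<Sum>s<length (bas d). pconst (v $ s) * (bas a ! r * bas d ! s)) = 0"
      by (simp add: q_def lin_comb_def sum_distrib_left mult_ac)
    then have "coords I [t] (bas a ! r * q) =
        vec (length [t]) (\<lambda>k. \<Sum>s<length (bas d). v $ s * coords I [t] (bas a ! r * bas d ! s) $ k)"
      by (intro coords_sum[OF is_ideal_I t] bqf) (auto simp: I_0)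
    also have "\<dots> = vec 1 (\<lambda>_. (pairing_mat I t (bas a) (bas d) *\<^sub>v v) $ r)"
      using r v(1) by (intro eq_vecI)
        (auto simp: pairing_mat_def scalar_prod_def lessThan_atLeast0 mult.commute)
    also have "\<dots> = 0\<^sub>v 1" using r v(2) by auto
    finally show ?thesis
      using coords(2)[OF is_ideal_I t, of "bas a ! r * q"] forms_mult[OF basis_mod_nth[OF basis r] q] e
      by (simp add: lin_comb_def)
  qed
  have "q \<in> I"
  proof (rule pairing_nondegenerate[OF e q])
    fix p :: "('n, 'k) mpol" assume p: "p \<in> forms a"
    define w where "w = coords I (bas a) p"
    have "p * q = q * (p - lin_comb (bas a) w) + (\<Sum>r<length (bas a). pconst (w $ r) * (bas a ! r * q))"
      by (simp add: lin_comb_def right_diff_distrib sum_distrib_left mult_ac)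
    also have "\<dots> \<in> I"
      unfolding w_def by (intro I_add I_sum I_mult coords(2)[OF is_ideal_I basis p] bq) simp
    finally show "p * q \<in> I" .
  qed
  then show "v = 0\<^sub>v (length (bas d))"
    using basis[of d] v(1) by (simp add: basis_mod_def q_def)
qed (use that in blast)

lemma length_basis_symmetric:
  assumes "a + d = e"
  shows "length (bas a) = length (bas d)"
proof -
  obtain t where t: "basis_mod I e [t]" by (rule basis_mod_top)
  have "length (bas d) \<le> length (bas a)" if "a + d = e" for a d
    using pairing_mat_left_inverse[OF t that] left_inverse_mat_dim_le[OF pairing_mat_carrier] by metis
  from this[of a d] this[of d a] assms show ?thesis by simp
qed

section \<open>Comparison of the locus ideals in different degrees\<close>

text \<open>Self-adjointness of each \<open>quad_monom u\<close> intertwines \<open>?B j\<close>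
  with the transpose of \<open>?B i\<close> through Gram matrices. Inverting these brings the
  relation into the form required by \<open>minors_ideal_mono\<close>, and transposing does not
  change the minors.\<close>

lemma nonlef_ideal_at_dual:
  assumes e: "i + j + 2 = e" and le: "length (bas j) \<le> length (bas (j + 2))"
  shows "nonlef_ideal_at I bas j \<subseteq> nonlef_ideal_at I bas i"
proof -
  let ?h = "\<lambda>i. length (bas i)"
  let ?B = "\<lambda>i. generic_quadric_mat I (bas i) (bas (i + 2))"
  let ?F = "\<lambda>i u. mult_mat I (bas i) (bas (i + 2)) (quad_monom u)"
  obtain t where t: "basis_mod I e [t]" by (rule basis_mod_top)
  let ?G = "\<lambda>a b. pairing_mat I t (bas a) (bas b)"
  have G: "?G a b \<in> carrier_mat (?h a) (?h b)" for a b by simp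
  obtain K1 where K1: "K1 \<in> carrier_mat (?h (j + 2)) (?h i)" "K1 * ?G i (j + 2) = 1\<^sub>m (?h (j + 2))"
    using pairing_mat_left_inverse[OF t, of i "j + 2"] e by auto
  obtain K2 where K2: "K2 \<in> carrier_mat (?h (i + 2)) (?h j)" "K2 * ?G j (i + 2) = 1\<^sub>m (?h (i + 2))"
    using pairing_mat_left_inverse[OF t, of j "i + 2"] e by auto
  have B: "?B i \<in> carrier_mat (?h (i + 2)) (?h i)" for i by (simp add: generic_quadric_mat_def)
  have F: "?F i u \<in> carrier_mat (?h (i + 2)) (?h i)" for i u by simp
  have "?G i (j + 2) * ?F j u = transpose_mat (?F i u) * ?G (i + 2) j" for u
    by (rule pairing_mat_mult_mat[OF is_ideal_I, of 2 j i])
      (use t e basis forms_quad_monom in \<open>auto simp: ac_simps\<close>)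
  then have eq: "map_mat pconst (?G i (j + 2)) * ?B j = transpose_mat (?B i) * map_mat pconst (?G (i + 2) j)"
    unfolding generic_quadric_mat_eq linear_mat_transpose[OF F]
    by (subst linear_mat_mult_left[OF F G], subst linear_mat_mult_right[OF _ G]) auto
  let ?P1 = "map_mat pconst (?G i (j + 2)) :: ('n uprod, 'k) mpol mat"
  let ?P2 = "map_mat pconst (?G (i + 2) j) :: ('n uprod, 'k) mpol mat"
  let ?L = "map_mat pconst (transpose_mat K2) :: ('n uprod, 'k) mpol mat"
  let ?L' = "map_mat pconst K1 :: ('n uprod, 'k) mpol mat"
  have P1: "?P1 \<in> carrier_mat (?h i) (?h (j + 2))" and P2: "?P2 \<in> carrier_mat (?h (i + 2)) (?h j)"
    and L: "?L \<in> carrier_mat (?h j) (?h (i + 2))" and L': "?L' \<in> carrier_mat (?h (j + 2)) (?h i)"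
    using K1 K2 by simp_all
  have Bt: "transpose_mat (?B i) \<in> carrier_mat (?h i) (?h (i + 2))" using B[of i] by simp
  \<comment> \<open>Transposing \<open>K2\<close> turns a left inverse of one Gram matrix into a
    right inverse of its transpose, so \<open>?P2\<close> serves as the left inverse of
    \<open>?L\<close>.\<close>
  have "?G (i + 2) j * transpose_mat K2 = transpose_mat (K2 * ?G j (i + 2))"
    by (simp add: transpose_mult[OF K2(1) G] pairing_mat_transpose)
  then have PL: "?P2 * ?L = 1\<^sub>m (?h (i + 2))"
    using K2 by (simp add: pconst.mat_hom_mult[OF G, symmetric] pconst.mat_hom_one)
  have LP: "?L' * ?P1 = 1\<^sub>m (?h (j + 2))"
    using K1 by (simp add: pconst.mat_hom_mult[OF K1(1) G, symmetric] pconst.mat_hom_one)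
  have "?B j * ?L = ?L' * ?P1 * ?B j * ?L" unfolding LP left_mult_one_mat[OF B] ..
  also have "\<dots> = ?L' * (?P1 * ?B j) * ?L" using assoc_mult_mat[OF L' P1 B[of j]] by simp
  also have "\<dots> = ?L' * (transpose_mat (?B i) * ?P2 * ?L)"
    unfolding eq using L' Bt P2 L by (intro assoc_mult_mat[of _ "?h (j + 2)" "?h i"]) auto
  also have "transpose_mat (?B i) * ?P2 * ?L = transpose_mat (?B i)"
    unfolding assoc_mult_mat[OF Bt P2 L] PL using Bt by simp
  finally show ?thesis
    unfolding nonlef_ideal_at_def maximal_minors_transpose[of "?B i", symmetric]
    by (intro minors_ideal_mono[OF Bt B le L P2 PL L'])
qed

lemma nonlef_ideal_at_step:
  assumes l: "l \<in> forms 1" and inj: "\<And>p. p \<in> forms i \<Longrightarrow> l * p \<in> I \<Longrightarrow> p \<in> I"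
    and le: "length (bas (Suc i)) \<le> length (bas (Suc i + 2))"
  shows "nonlef_ideal_at I bas (Suc i) \<subseteq> nonlef_ideal_at I bas i"
proof -
  let ?h = "\<lambda>i. length (bas i)"
  let ?M = "\<lambda>i j. mult_mat I (bas i) (bas j)"
  let ?B = "\<lambda>i. generic_quadric_mat I (bas i) (bas (i + 2))"
  have b: "basis_mod I (1 + i) (bas (Suc i))" "basis_mod I (2 + (1 + i)) (bas (Suc i + 2))"
    "basis_mod I (2 + i) (bas (i + 2))" "basis_mod I (1 + (2 + i)) (bas (Suc i + 2))"
    using basis[of "Suc i"] basis[of "Suc i + 2"] basis[of "i + 2"] by simp_all
  obtain K where K: "K \<in> carrier_mat (?h i) (?h (Suc i))" "K * ?M i (Suc i) l = 1\<^sub>m (?h i)"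
    using inj_graded_mult[OF is_ideal_I basis b(1) l inj] by blast
  have M: "?M i j f \<in> carrier_mat (?h j) (?h i)" for i j f by simp
  have B: "?B i \<in> carrier_mat (?h (i + 2)) (?h i)" for i by (simp add: generic_quadric_mat_def)
  \<comment> \<open>Both sides are the matrix of multiplication by \<open>l * quad_monom u\<close>
    from degree \<open>i\<close> to degree \<open>i + 3\<close>.\<close>
  have "?M (Suc i) (Suc i + 2) (quad_monom u) * ?M i (Suc i) l =
      ?M (i + 2) (Suc i + 2) l * ?M i (i + 2) (quad_monom u)" for u
    unfolding mult_mat_mult[OF is_ideal_I basis b(1,2) l forms_quad_monom]
      mult_mat_mult[OF is_ideal_I basis b(3,4) forms_quad_monom l]
    by (simp add: mult.commute)
  then have eq: "?B (Suc i) * map_mat pconst (?M i (Suc i) l) =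
      map_mat pconst (?M (i + 2) (Suc i + 2) l) * ?B i"
    unfolding generic_quadric_mat_eq
    by (subst linear_mat_mult_left[OF M M], subst linear_mat_mult_right[OF M M]) simp
  have "map_mat pconst K * map_mat pconst (?M i (Suc i) l) = (1\<^sub>m (?h i) :: ('n uprod, 'k) mpol mat)"
    using K by (simp add: pconst.mat_hom_mult[OF K(1) M, symmetric] pconst.mat_hom_one)
  then show ?thesis
    unfolding nonlef_ideal_at_def
    by (intro minors_ideal_mono[OF B B le _ _ _ _ eq]) (use K in auto)
qed

section \<open>Consequences of the Weak Lefschetz Property\<close>

text \<open>The algebra is generated in degree 1: a monomial of degree \<open>i + 2\<close> is a
  variable times one of degree \<open>i + 1\<close>, and multiplying a preimage of the latter by
  that variable gives a preimage of the former.\<close>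

lemma surjective_mult_Suc:
  assumes l: "l \<in> forms 1"
    and surj: "\<And>q. q \<in> forms (Suc i) \<Longrightarrow> \<exists>p\<in>forms i. q - l * p \<in> I"
    and q: "q \<in> forms (Suc (Suc i))"
  shows "\<exists>p\<in>forms (Suc i). q - l * p \<in> I"
proof -
  have "\<exists>p\<in>forms (Suc i). Poly_Mapping.single m (Poly_Mapping.lookup q m) - l * p \<in> I"
    if "m \<in> Poly_Mapping.keys q" for m
  proof -
    have "mdeg m = Suc (Suc i)" using q that by (simp add: forms_def)
    then obtain j m' where m': "mdeg m' = Suc i"
      "Poly_Mapping.single m (Poly_Mapping.lookup q m) =
        pvar j * Poly_Mapping.single m' (Poly_Mapping.lookup q m)"
      by (rule monomial_Suc)
    obtain p where p: "p \<in> forms i" "Poly_Mapping.single m' (Poly_Mapping.lookup q m) - l * p \<in> I"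
      using surj[OF forms_single[OF m'(1)]] by blast
    have "Poly_Mapping.single m (Poly_Mapping.lookup q m) - l * (pvar j * p) =
        pvar j * (Poly_Mapping.single m' (Poly_Mapping.lookup q m) - l * p)"
      unfolding m'(2) by (simp add: algebra_simps)
    also have "\<dots> \<in> I" by (intro I_mult p)
    finally show ?thesis using forms_mult[OF forms_pvar p(1), of j] by auto
  qed
  then obtain p where p: "\<And>m. m \<in> Poly_Mapping.keys q \<Longrightarrow> p m \<in> forms (Suc i)"
    "\<And>m. m \<in> Poly_Mapping.keys q \<Longrightarrow> Poly_Mapping.single m (Poly_Mapping.lookup q m) - l * p m \<in> I"
    by metis
  have "q - l * (\<Sum>m\<in>Poly_Mapping.keys q. p m) =
      (\<Sum>m\<in>Poly_Mapping.keys q. Poly_Mapping.single m (Poly_Mapping.lookup q m) - l * p m)"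
    by (subst mpol_sum_monomials[of q]) (simp add: sum_distrib_left sum_subtractf)
  also have "\<dots> \<in> I" by (intro I_sum p)
  finally show ?thesis using forms_sum[of "Poly_Mapping.keys q" p] p(1) by blast
qed

lemma weak_lefschetz_injective:
  assumes "weak_lefschetz I"
  obtains l where "l \<in> forms 1"
    "\<And>i p. 2 * i + 1 \<le> e \<Longrightarrow> p \<in> forms i \<Longrightarrow> l * p \<in> I \<Longrightarrow> p \<in> I"
proof -
  obtain l where l: "l \<in> forms 1" and max_rank: "\<And>i.
      (\<forall>p\<in>forms i. \<forall>q\<in>forms i. l * p - l * q \<in> I \<longrightarrow> p - q \<in> I) \<or>
      (\<forall>q\<in>forms (Suc i). \<exists>p\<in>forms i. q - l * p \<in> I)"
    using assms unfolding weak_lefschetz_def by blast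
  have "p \<in> I" if i: "2 * i + 1 \<le> e" and p: "p \<in> forms i" "l * p \<in> I" for i p
    using max_rank[of i]
  proof
    assume "\<forall>p\<in>forms i. \<forall>q\<in>forms i. l * p - l * q \<in> I \<longrightarrow> p - q \<in> I"
    from this[rule_format, OF p(1) forms_0] p(2) show ?thesis by simp
  next
    assume surj_i: "\<forall>q\<in>forms (Suc i). \<exists>p\<in>forms i. q - l * p \<in> I"
    have surj: "\<exists>p\<in>forms k. q - l * p \<in> I" if "i \<le> k" "q \<in> forms (Suc k)" for k q
      using that
    proof (induction k arbitrary: q rule: dec_induct)
      case base
      with surj_i show ?case by blast
    next
      case (step k)
      then show ?case using surjective_mult_Suc[OF l] by blast
    qed
    show ?thesis
    proof (rule pairing_nondegenerate[of "e - i" i])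
      fix q :: "('n, 'k) mpol" assume "q \<in> forms (e - i)"
      \<comment> \<open>Here \<open>2 * i + 1 <= e\<close> enters: it places degree
        \<open>e - i - 1\<close> at or above \<open>i\<close>, where surjectivity has
        propagated.\<close>
      moreover have "e - i = Suc (e - i - 1)" "i \<le> e - i - 1" using i by linarith+
      ultimately obtain q' where "q - l * q' \<in> I" using surj[of "e - i - 1" q] by auto
      \<comment> \<open>The sum equals \<open>q * p\<close>: the parts containing \<open>l\<close>
        cancel, so \<open>l * p \<in> I\<close> makes \<open>p\<close> annihilate all of degree
        \<open>e - i\<close>.\<close>
      then have "p * (q - l * q') + q' * (l * p) \<in> I" by (intro I_add I_mult p)
      then show "q * p \<in> I" by (simp add: algebra_simps)
    qed (use i p in auto)
  qed
  then show ?thesis using that l by blast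
qed

lemma nonlef_ideal_eq_middle:
  assumes wl: "weak_lefschetz I" and e: "2 \<le> e"
  shows "nonlef_ideal I bas e = nonlef_ideal_at I bas (e div 2 - 1)"
proof -
  let ?h = "\<lambda>i. length (bas i)"
  define m where "m = e div 2 - 1"
  \<comment> \<open>Both parities at once: \<open>e\<close> is \<open>2 * m + 2\<close> or
    \<open>2 * m + 3\<close>.\<close>
  have m: "2 * m + 2 \<le> e" "e \<le> 2 * m + 3" using e by (auto simp: m_def)
  obtain l where l: "l \<in> forms 1"
    and inj: "\<And>i p. 2 * i + 1 \<le> e \<Longrightarrow> p \<in> forms i \<Longrightarrow> l * p \<in> I \<Longrightarrow> p \<in> I"
    by (rule weak_lefschetz_injective[OF wl]) blast
  have h_Suc: "?h i \<le> ?h (Suc i)" if "2 * i + 1 \<le> e" for i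
    using inj_graded_mult[OF is_ideal_I basis _ l inj[OF that], where bs' = "bas (Suc i)"] basis[of "Suc i"] by auto
  \<comment> \<open>Two injective multiplications by \<open>l\<close> suffice except when
    \<open>e\<close> is even and \<open>i = m\<close>; then degrees \<open>m\<close> and
    \<open>m + 2\<close> are dual and have equal dimension.\<close>
  have h2: "?h i \<le> ?h (i + 2)" if "i \<le> m" for i
  proof (cases "2 * i + 3 \<le> e")
    case True
    then show ?thesis using h_Suc[of i] h_Suc[of "Suc i"] by simp
  next
    case False
    then have "i + (i + 2) = e" using that m by linarith
    then show ?thesis using length_basis_symmetric by simp
  qed
  have below: "nonlef_ideal_at I bas m \<subseteq> nonlef_ideal_at I bas i" if "i \<le> m" for i
    using that
  proof (induction i rule: inc_induct)
    case (step i)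
    have "nonlef_ideal_at I bas (Suc i) \<subseteq> nonlef_ideal_at I bas i"
      by (rule nonlef_ideal_at_step[OF l inj h2]) (use step m in auto)
    then show ?case using step by blast
  qed simp
  have "nonlef_ideal_at I bas m \<subseteq> nonlef_ideal_at I bas i" if i: "i + 2 \<le> e" for i
  proof (cases "i \<le> m")
    case False
    \<comment> \<open>Reflecting a degree above \<open>m\<close> lands at or below \<open>m\<close>,
      since \<open>e <= 2 * m + 3\<close>.\<close>
    define j where "j = e - 2 - i"
    have j: "i + j + 2 = e" "j \<le> m" using i False m by (auto simp: j_def)
    show ?thesis
      using below[OF j(2)] nonlef_ideal_at_dual[OF j(1) h2[OF j(2)]] by blast
  qed (rule below)
  then show ?thesis
    unfolding nonlef_ideal_def m_def[symmetric] using m by auto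
qed

text \<open>The target degree exceeds the socle degree, so its basis is empty and the only maximal
  minor is the empty determinant 1.\<close>

lemma nonlef_ideal_at_unit:
  assumes "e < i + 2"
  shows "nonlef_ideal_at I bas i = UNIV"
proof -
  let ?B = "generic_quadric_mat I (bas i) (bas (i + 2))"
  have "bas (i + 2) = []"
  proof (rule ccontr)
    \<comment> \<open>Every combination of basis elements lies in \<open>I\<close> in this degree,
      so the all-ones vector would be a nontrivial relation if the basis were nonempty.\<close>
    let ?v = "vec (length (bas (i + 2))) (\<lambda>_. 1 :: 'k)"
    assume "bas (i + 2) \<noteq> []"
    then have "?v $ 0 \<noteq> 0\<^sub>v (length (bas (i + 2))) $ 0" by simp
    moreover have "lin_comb (bas (i + 2)) ?v \<in> forms (i + 2)"
      using basis[of "i + 2"] by (intro forms_lin_comb) (simp add: basis_mod_def)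
    then have "?v = 0\<^sub>v (length (bas (i + 2)))"
      using basis[of "i + 2"] forms_gt_subset[OF assms] by (auto simp: basis_mod_def)
    ultimately show False by metis
  qed
  then have "dim_row ?B = 0" by (simp add: generic_quadric_mat_def)
  moreover from this have "det (submatrix ?B {} {}) = 1" by (intro det_dim_zero) (auto simp: dim_submatrix)
  ultimately have "1 \<in> maximal_minors ?B"
    unfolding maximal_minors_def by (intro CollectI exI[of _ "{}"]) auto
  then have "c * 1 \<in> nonlef_ideal_at I bas i" for c
    unfolding nonlef_ideal_at_def by (intro ideal.span_scale ideal.span_base)
  then show ?thesis by auto
qed

end

theorem theorem2p10:
  fixes I :: "('n::finite, 'k::{alg_closed_field, field_char_0}) mpol set"
    and bas :: "nat \<Rightarrow> ('n, 'k) mpol list"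
    and e :: nat
  assumes "homogeneous_ideal I"
    and "gorenstein_artinian I"
    and "socle_degree I e"
    and "weak_lefschetz I"
    and "\<And>i. basis_mod I i (bas i)"
  shows "nonlef_ideal I bas e = nonlef_ideal_at I bas (e div 2 - 1)"
proof -
  interpret gorenstein_algebra I bas e
    by unfold_locales (use assms in auto)
  show ?thesis
  proof (cases "2 \<le> e")
    case True
    with assms(4) show ?thesis by (rule nonlef_ideal_eq_middle)
  next
    \<comment> \<open>For \<open>e < 2\<close> the intersection has no members and is everything;
      the truncated index is 0, where the ideal is the unit ideal.\<close>
    case False
    then show ?thesis
      using nonlef_ideal_at_unit[of 0] by (auto simp: nonlef_ideal_def)
  qed
qed

end
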